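(* For a unital $*$-isometry $\varphi:\mathrm{Mat}_d(\mathbb C)\to\mathrm{Mat}_r(\mathbb C)$, the following are equivalent: (i) The free spectrahedron defined by $\varphi$ is contained in $\mathrm{Psd}_d$ or in $\mathrm{Psd}_d^\Gamma$. (ii) There exists $V\in\mathrm{Mat}_{r,d}(\mathbb C)$ such that either $V^*\varphi(A)V=A$ for all $A\in\mathrm{Mat}_d(\mathbb C)$, or $V^*\varphi(A)V=A^T$ for all $A\in\mathrm{Mat}_d(\mathbb C)$. (iii) There exist a unitary $U\in\mathrm{Mat}_r(\mathbb C)$ and a map $\psi:\mathrm{Mat}_d(\mathbb C)\to\mathrm{Mat}_{r-d}(\mathbb C)$ such that either $$U^*\varphi(A)U=\begin{pmatrix}A&0\\0&\psi(A)\end{pmatrix}\ \text{ for all }A\in\mathrm{Mat}_d(\mathbb C),\quad\text{or}\quad U^*\varphi(A)U=\begin{pmatrix}A^T&0\\0&\psi(A)\end{pmatrix}\ \text{ for all }A\in\mathrm{Mat}_d(\mathbb C).$$ (iv) There are unit vectors $h_1,\dots,h_d\in\mathbb C^r$ such that either $\varphi(E_{ij})h_s=\delta_{js}h_i$ for all $i,j,s\in\{1,\dots,d\}$, or $\varphi(E_{ij})h_s=\delta_{is}h_j$ for all $i,j,s\in\{1,\dots,d\}$.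
   Context: A unital $*$-isometry $\varphi:\mathrm{Mat}_d(\mathbb C)\to\mathrm{Mat}_r(\mathbb C)$ is a $\mathbb C$-linear map with $\varphi(A^* )=\varphi(A)^*$, $\varphi(I_d)=I_r$ and $\|\varphi(A)\|=\|A\|$ for all $A$, where $\|\cdot\|$ is the operator (spectral) norm. $E_{ij}$ are the standard matrix units in $\mathrm{Mat}_d(\mathbb C)$ and $\delta$ is the Kronecker delta; $\geqslant0$ means positive semidefinite. The lower right block in (iii) is absent if $r=d$. The free spectrahedron defined by $\varphi$ is the family $(\mathcal C_s)_{s\geqslant1}$ with $\mathcal C_s=\{A\in\mathrm{Her}_s(\mathbb C)\otimes\mathrm{Her}_d(\mathbb C)\mid(\mathrm{id}\otimes\varphi)(A)\geqslant0\}$. The families $\mathrm{Psd}_d=(\mathrm{Psd}_{d,s})_{s\geqslant1}$ and $\mathrm{Psd}_d^\Gamma=(\mathrm{Psd}_{d,s}^\Gamma)_{s\geqslant1}$ are defined by $\mathrm{Psd}_{d,s}=\{A\in\mathrm{Her}_s(\mathbb C)\otimes\mathrm{Her}_d(\mathbb C)\mid A\geqslant0\}$ and $\mathrm{Psd}^\Gamma_{d,s}=\{\sum_iA_i\otimes B_i\in\mathrm{Her}_s(\mathbb C)\otimes\mathrm{Her}_d(\mathbb C)\mid\sum_iA_i\otimes B_i^T\geqslant0\}$. Containment of families means containment at every level $s\geqslant1$. *)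

theory Defs
  imports
    "HOL-Library.FuncSet"
    "Jordan_Normal_Form.Matrix"
    "Jordan_Normal_Form.Schur_Decomposition"
begin

definition euclid_norm :: "complex vec \<Rightarrow> real" where
  "euclid_norm v = sqrt (\<Sum>i<dim_vec v. (cmod (v $ i))\<^sup>2)"

definition op_norm :: "complex mat \<Rightarrow> real" where
  "op_norm A = (SUP v\<in>{v \<in> carrier_vec (dim_col A). euclid_norm v \<le> 1}. euclid_norm (A *\<^sub>v v))"

definition hermitian_mats :: "nat \<Rightarrow> complex mat set" where
  "hermitian_mats n = {A \<in> carrier_mat n n. mat_adjoint A = A}"

definition psd :: "complex mat \<Rightarrow> bool" where
  "psd A \<longleftrightarrow> A \<in> hermitian_mats (dim_row A) \<and>
    (\<forall>v\<in>carrier_vec (dim_row A). 0 \<le> (A *\<^sub>v v) \<bullet>c v)"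

definition unitary_mat :: "nat \<Rightarrow> complex mat \<Rightarrow> bool" where
  "unitary_mat n U \<longleftrightarrow> U \<in> carrier_mat n n \<and>
    mat_adjoint U * U = 1\<^sub>m n \<and> U * mat_adjoint U = 1\<^sub>m n"

definition matrix_unit :: "nat \<Rightarrow> nat \<Rightarrow> nat \<Rightarrow> complex mat" where
  "matrix_unit d i j = mat d d (\<lambda>(a, b). if a = i \<and> b = j then 1 else 0)"

definition unital_star_isometry ::
  "nat \<Rightarrow> nat \<Rightarrow> (complex mat \<Rightarrow> complex mat) \<Rightarrow> bool" where
  "unital_star_isometry d r \<phi> \<longleftrightarrow>
    \<phi> \<in> carrier_mat d d \<rightarrow> carrier_mat r r \<and>
    (\<forall>A\<in>carrier_mat d d. \<forall>B\<in>carrier_mat d d. \<phi> (A + B) = \<phi> A + \<phi> B) \<and>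
    (\<forall>c. \<forall>A\<in>carrier_mat d d. \<phi> (c \<cdot>\<^sub>m A) = c \<cdot>\<^sub>m \<phi> A) \<and>
    (\<forall>A\<in>carrier_mat d d. \<phi> (mat_adjoint A) = mat_adjoint (\<phi> A)) \<and>
    \<phi> (1\<^sub>m d) = 1\<^sub>m r \<and>
    (\<forall>A\<in>carrier_mat d d. op_norm (\<phi> A) = op_norm A)"

text \<open>
  The tensor product \<open>Mat\<^sub>s \<otimes> Mat\<^sub>d\<close> is identified with \<open>Mat\<^sub>s\<^sub>d\<close> via the Kronecker product, so
  an element is an \<open>s \<times> s\<close> block matrix with blocks of size \<open>d \<times> d\<close>.
\<close>

definition kron :: "complex mat \<Rightarrow> complex mat \<Rightarrow> complex mat" where
  "kron A B = mat (dim_row A * dim_row B) (dim_col A * dim_col B)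
    (\<lambda>(i, j). A $$ (i div dim_row B, j div dim_col B) * B $$ (i mod dim_row B, j mod dim_col B))"

text \<open>The element \<open>\<Sum>k<N. X k \<otimes> Y k\<close> of \<open>Mat\<^sub>s \<otimes> Mat\<^sub>d\<close>.\<close>

definition tensor_sum ::
  "nat \<Rightarrow> nat \<Rightarrow> nat \<Rightarrow> (nat \<Rightarrow> complex mat) \<Rightarrow> (nat \<Rightarrow> complex mat) \<Rightarrow> complex mat" where
  "tensor_sum s d N X Y = mat (s * d) (s * d) (\<lambda>ij. \<Sum>k<N. kron (X k) (Y k) $$ ij)"

definition her_tensor :: "nat \<Rightarrow> nat \<Rightarrow> complex mat set" where
  "her_tensor s d = {tensor_sum s d N X Y | N X Y.
    \<forall>k<N. X k \<in> hermitian_mats s \<and> Y k \<in> hermitian_mats d}"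

definition block :: "nat \<Rightarrow> complex mat \<Rightarrow> nat \<Rightarrow> nat \<Rightarrow> complex mat" where
  "block d M k l = mat d d (\<lambda>(i, j). M $$ (k * d + i, l * d + j))"

text \<open>
  \<open>id \<otimes> \<phi>\<close> on \<open>Mat\<^sub>s \<otimes> Mat\<^sub>d\<close>: apply \<open>\<phi>\<close> to every block. For linear \<open>\<phi>\<close> it sends
  \<open>\<Sum>k. X k \<otimes> Y k\<close> to \<open>\<Sum>k. X k \<otimes> \<phi> (Y k)\<close>, see \<open>id_tensor_tensor_sum\<close> below.
\<close>

definition id_tensor ::
  "nat \<Rightarrow> nat \<Rightarrow> nat \<Rightarrow> (complex mat \<Rightarrow> complex mat) \<Rightarrow> complex mat \<Rightarrow> complex mat" where
  "id_tensor s d r \<phi> M = mat (s * r) (s * r)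
    (\<lambda>(i, j). \<phi> (block d M (i div r) (j div r)) $$ (i mod r, j mod r))"

definition free_spectrahedron ::
  "nat \<Rightarrow> nat \<Rightarrow> (complex mat \<Rightarrow> complex mat) \<Rightarrow> nat \<Rightarrow> complex mat set" where
  "free_spectrahedron d r \<phi> s = {A \<in> her_tensor s d. psd (id_tensor s d r \<phi> A)}"

definition Psd :: "nat \<Rightarrow> nat \<Rightarrow> complex mat set" where
  "Psd d s = {A \<in> her_tensor s d. psd A}"

definition Psd_Gamma :: "nat \<Rightarrow> nat \<Rightarrow> complex mat set" where
  "Psd_Gamma d s = {tensor_sum s d N X Y | N X Y.
    (\<forall>k<N. X k \<in> hermitian_mats s \<and> Y k \<in> hermitian_mats d) \<and>
    psd (tensor_sum s d N X (\<lambda>k. transpose_mat (Y k)))}"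

definition all_equivalent :: "bool list \<Rightarrow> bool" where
  "all_equivalent Ps \<longleftrightarrow> (\<forall>P\<in>set Ps. \<forall>Q\<in>set Ps. P \<longleftrightarrow> Q)"


subsection \<open>The tensor encoding\<close>

lemma div_less_mult: "i < s * r \<Longrightarrow> i div r < s" for i s r :: nat
  by (simp add: less_mult_imp_div_less)

lemma mod_less_mult: "i < s * r \<Longrightarrow> i mod r < r" for i s r :: nat
  by (cases "r = 0") auto

lemma block_index_less: "k < s \<Longrightarrow> a < d \<Longrightarrow> k * d + a < s * d" for k s a d :: nat
proof -
  assume "k < s" "a < d"
  then have "k * d + a < Suc k * d" by simp
  also have "\<dots> \<le> s * d" using \<open>k < s\<close> by (intro mult_le_mono1) simp
  finally show ?thesis .
qed

lemma block_tensor_sum: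
  assumes "\<forall>k<N. X k \<in> carrier_mat s s \<and> Y k \<in> carrier_mat d d" "p < s" "q < s"
  shows "block d (tensor_sum s d N X Y) p q = mat d d (\<lambda>ij. \<Sum>k<N. X k $$ (p, q) * Y k $$ ij)"
proof (rule eq_matI; simp)
  fix i j assume ij: "i < d" "j < d"
  have "kron (X k) (Y k) $$ (p * d + i, q * d + j) = X k $$ (p, q) * Y k $$ (i, j)"
    if "k < N" for k
  proof -
    have "X k \<in> carrier_mat s s" "Y k \<in> carrier_mat d d" using assms that by auto
    then show ?thesis using ij assms(2,3)
      by (simp add: kron_def block_index_less)
  qed
  then show "block d (tensor_sum s d N X Y) p q $$ (i, j) =
    (\<Sum>k<N. X k $$ (p, q) * Y k $$ (i, j))"
    using ij assms(2,3) by (simp add: block_def tensor_sum_def block_index_less)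
qed (simp_all add: block_def)

lemma linear_mat_sum:
  fixes \<phi> :: "complex mat \<Rightarrow> complex mat" and c :: "nat \<Rightarrow> complex"
  assumes maps: "\<phi> \<in> carrier_mat d d \<rightarrow> carrier_mat r r"
    and add: "\<forall>A\<in>carrier_mat d d. \<forall>B\<in>carrier_mat d d. \<phi> (A + B) = \<phi> A + \<phi> B"
    and smult: "\<forall>c. \<forall>A\<in>carrier_mat d d. \<phi> (c \<cdot>\<^sub>m A) = c \<cdot>\<^sub>m \<phi> A"
    and Y: "\<forall>k<N. Y k \<in> carrier_mat d d"
  shows "\<phi> (mat d d (\<lambda>ij. \<Sum>k<N. c k * Y k $$ ij)) = mat r r (\<lambda>ij. \<Sum>k<N. c k * \<phi> (Y k) $$ ij)"
  using Y
proof (induction N)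
  case 0
  have z: "mat d d (\<lambda>ij. \<Sum>k<0. c k * Y k $$ ij) = 0 \<cdot>\<^sub>m 0\<^sub>m d d" by (rule eq_matI) auto
  have "\<phi> (0 \<cdot>\<^sub>m 0\<^sub>m d d) = 0 \<cdot>\<^sub>m \<phi> (0\<^sub>m d d)"
    by (rule smult[rule_format, OF zero_carrier_mat])
  also have "\<dots> = mat r r (\<lambda>ij. \<Sum>k<0. c k * \<phi> (Y k) $$ ij)"
    using funcset_mem[OF maps zero_carrier_mat] by (intro eq_matI) auto
  finally show ?case unfolding z .
next
  case (Suc N)
  let ?S = "mat d d (\<lambda>ij. \<Sum>k<N. c k * Y k $$ ij)"
  have Yc: "Y N \<in> carrier_mat d d" using Suc.prems by auto
  then have "\<phi> (Y N) \<in> carrier_mat r r" using maps by auto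
  have eq: "mat d d (\<lambda>ij. \<Sum>k<Suc N. c k * Y k $$ ij) = ?S + c N \<cdot>\<^sub>m Y N"
    using Yc by (intro eq_matI) auto
  have "\<phi> (?S + c N \<cdot>\<^sub>m Y N) = \<phi> ?S + c N \<cdot>\<^sub>m \<phi> (Y N)"
    using add smult Yc by simp
  also have "\<phi> ?S = mat r r (\<lambda>ij. \<Sum>k<N. c k * \<phi> (Y k) $$ ij)" using Suc by simp
  also have "\<dots> + c N \<cdot>\<^sub>m \<phi> (Y N) = mat r r (\<lambda>ij. \<Sum>k<Suc N. c k * \<phi> (Y k) $$ ij)"
    using \<open>\<phi> (Y N) \<in> carrier_mat r r\<close> by (intro eq_matI) auto
  finally show ?case unfolding eq .
qed

lemma id_tensor_tensor_sum:
  assumes maps: "\<phi> \<in> carrier_mat d d \<rightarrow> carrier_mat r r"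
    and add: "\<forall>A\<in>carrier_mat d d. \<forall>B\<in>carrier_mat d d. \<phi> (A + B) = \<phi> A + \<phi> B"
    and smult: "\<forall>c. \<forall>A\<in>carrier_mat d d. \<phi> (c \<cdot>\<^sub>m A) = c \<cdot>\<^sub>m \<phi> A"
    and XY: "\<forall>k<N. X k \<in> carrier_mat s s \<and> Y k \<in> carrier_mat d d"
  shows "id_tensor s d r \<phi> (tensor_sum s d N X Y) = tensor_sum s r N X (\<lambda>k. \<phi> (Y k))"
proof (rule eq_matI; simp add: id_tensor_def tensor_sum_def)
  fix i j assume ij: "i < s * r" "j < s * r"
  let ?b = "block d (tensor_sum s d N X Y) (i div r) (j div r)"
  have "?b = mat d d (\<lambda>ij. \<Sum>k<N. X k $$ (i div r, j div r) * Y k $$ ij)"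
    using XY ij by (intro block_tensor_sum) (auto simp: div_less_mult)
  then have "\<phi> ?b = mat r r (\<lambda>ij. \<Sum>k<N. X k $$ (i div r, j div r) * \<phi> (Y k) $$ ij)"
    using linear_mat_sum[OF maps add smult, of N Y "\<lambda>k. X k $$ (i div r, j div r)"] XY by simp
  then have "\<phi> ?b $$ (i mod r, j mod r) =
      (\<Sum>k<N. X k $$ (i div r, j div r) * \<phi> (Y k) $$ (i mod r, j mod r))"
    using ij by (simp add: mod_less_mult)
  also have "\<dots> = (\<Sum>k<N. kron (X k) (\<phi> (Y k)) $$ (i, j))"
  proof (rule sum.cong)
    fix k assume "k \<in> {..<N}"
    then have "X k \<in> carrier_mat s s" "\<phi> (Y k) \<in> carrier_mat r r" using XY maps by auto
    then show "X k $$ (i div r, j div r) * \<phi> (Y k) $$ (i mod r, j mod r) =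
      kron (X k) (\<phi> (Y k)) $$ (i, j)" using ij by (simp add: kron_def)
  qed simp
  finally show "\<phi> (block d (mat (s * d) (s * d) (\<lambda>ij. \<Sum>k<N. kron (X k) (Y k) $$ ij))
      (i div r) (j div r)) $$ (i mod r, j mod r) =
    (\<Sum>k<N. kron (X k) (\<phi> (Y k)) $$ (i, j))"
    by (simp add: tensor_sum_def)
qed

lemma hermitian_mats_iff:
  "A \<in> hermitian_mats n \<longleftrightarrow> A \<in> carrier_mat n n \<and> (\<forall>i<n. \<forall>j<n. cnj (A $$ (j, i)) = A $$ (i, j))"
  unfolding hermitian_mats_def
  by (auto simp: mat_adjoint_def mat_eq_iff mat_of_rows_index)

lemma Psd_Gamma_partial_transpose:
  "Psd_Gamma d s = {A \<in> her_tensor s d. psd (id_tensor s d d transpose_mat A)}"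
proof -
  have "id_tensor s d d transpose_mat (tensor_sum s d N X Y) =
      tensor_sum s d N X (\<lambda>k. transpose_mat (Y k))"
    if "\<forall>k<N. X k \<in> hermitian_mats s \<and> Y k \<in> hermitian_mats d" for N X Y
    using that by (intro id_tensor_tensor_sum) (auto simp: hermitian_mats_def transpose_add)
  then show ?thesis unfolding Psd_Gamma_def her_tensor_def mem_Collect_eq
    by (intro Collect_cong) metis
qed

end

theory Submission
  imports Defs
begin

text \<open>
  The implication from (i) to (iv) carries the theorem. A unital \<open>*\<close>-isometry is positive, and
  positivity alone gives a trace inequality: for all vectors \<open>v\<^sub>0, \<dots>, v\<^bsub>d-1\<^esub>\<close>,
  \<open>\<Sum>k l. \<langle>\<phi>(E\<^bsub>kl\<^esub>) v\<^sub>l, v\<^sub>k\<rangle> \<le> d * \<Sum>k. \<parallel>v\<^sub>k\<parallel>\<^sup>2\<close>. Indeed, with \<open>\<Omega> = \<Sum>k l. E\<^bsub>kl\<^esub> \<otimes> E\<^bsub>kl\<^esub>\<close>, the matrix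
  \<open>d I - \<Omega>\<close> is a finite sum of tensor products of positive rank one matrices, so
  \<open>id \<otimes> \<phi>\<close> keeps it positive although \<open>\<phi>\<close> need not be completely positive. The difference of the two sides is thus a sum of terms
  \<open>\<langle>\<phi>(x x*) y, y\<rangle>\<close>, where \<open>x\<close> is \<open>e\<^sub>i\<close> or \<open>e\<^sub>i + z e\<^sub>j\<close>, \<open>y\<close> is \<open>v\<^sub>j\<close> or \<open>v\<^sub>i - z v\<^sub>j\<close>, \<open>i \<noteq> j\<close> and \<open>z\<close> runs
  over the fourth roots of unity (\<open>defect_eq\<close>). In the case of equality every term vanishes, so every
  \<open>\<phi>(x x*)\<close> annihilates its \<open>y\<close>; separating the powers of \<open>z\<close> in these equations leaves exactly
  \<open>\<phi>(E\<^bsub>ij\<^esub>) v\<^sub>s = \<delta>\<^bsub>js\<^esub> v\<^sub>i\<close> (\<open>defect_zero_imp_matrix_unit_action\<close>).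

  Containment of the free spectrahedron in \<open>Psd\<close> forces equality for some nonzero family \<open>v\<close>
  if \<open>d > 0\<close>.
  Otherwise \<open>(id \<otimes> \<phi>)(d I - \<Omega>)\<close> has trivial kernel and is bounded below by some \<open>e > 0\<close>, so
  \<open>(d - e) I - \<Omega>\<close> belongs to the spectrahedron and would be positive semidefinite. But \<open>\<Omega>\<close> has the
  eigenvalue \<open>d\<close>, with eigenvector \<open>\<Sum>k. e\<^sub>k \<otimes> e\<^sub>k\<close>.

  The other steps are geometric. Vectors as in (iv) are orthonormal and span a subspace that
  reduces all \<open>\<phi>(A)\<close>, on which \<open>\<phi>(A)\<close> acts as \<open>A\<close>; an orthonormal basis adapted to it gives (iii), and
  its first \<open>d\<close> columns give (ii). From (ii), \<open>A = (I \<otimes> V)* ((id \<otimes> \<phi>)(A)) (I \<otimes> V)\<close> is positive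
  semidefinite whenever \<open>(id \<otimes> \<phi>)(A)\<close> is. The second alternative of each condition is the first one
  for \<open>A \<mapsto> \<phi>(A\<^sup>T)\<close>, which is again unital and positive.
\<close>

section \<open>Hermitian geometry of complex vectors\<close>

lemma cinner_eq_sum:
  fixes v w :: "complex vec"
  assumes "w \<in> carrier_vec n"
  shows "v \<bullet>c w = (\<Sum>i<n. v $ i * cnj (w $ i))"
  using assms by (simp add: scalar_prod_def lessThan_atLeast0)

lemma mat_adjoint_carrier [simp]:
  "A \<in> carrier_mat m n \<Longrightarrow> mat_adjoint A \<in> carrier_mat n m" for A :: "complex mat"
  by (auto simp: mat_adjoint_def)

lemma dim_mat_adjoint [simp]:
  "dim_row (mat_adjoint A) = dim_col A" "dim_col (mat_adjoint A) = dim_row A" for A :: "complex mat"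
  by (auto simp: mat_adjoint_def)

lemma mat_adjoint_index [simp]:
  "A \<in> carrier_mat m n \<Longrightarrow> i < n \<Longrightarrow> j < m \<Longrightarrow> mat_adjoint A $$ (i, j) = cnj (A $$ (j, i))"
  by (auto simp: mat_adjoint_def mat_of_rows_index)

lemma mult_mat_vec_index_sum:
  fixes A :: "complex mat"
  assumes "A \<in> carrier_mat m n" "v \<in> carrier_vec n" "i < m"
  shows "(A *\<^sub>v v) $ i = (\<Sum>j<n. A $$ (i, j) * v $ j)"
  using assms by (simp add: scalar_prod_def lessThan_atLeast0)

lemma cinner_adjoint:
  fixes v w :: "complex vec"
  assumes A: "A \<in> carrier_mat m n" and v: "v \<in> carrier_vec n" and w: "w \<in> carrier_vec m"
  shows "(A *\<^sub>v v) \<bullet>c w = v \<bullet>c (mat_adjoint A *\<^sub>v w)"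
proof -
  have "(A *\<^sub>v v) \<bullet>c w = (\<Sum>i<m. \<Sum>j<n. A $$ (i, j) * v $ j * cnj (w $ i))"
    using A v w by (simp add: cinner_eq_sum mult_mat_vec_index_sum sum_distrib_right
        del: index_mult_mat_vec)
  also have "\<dots> = (\<Sum>j<n. \<Sum>i<m. A $$ (i, j) * v $ j * cnj (w $ i))"
    by (rule sum.swap)
  also have "\<dots> = v \<bullet>c (mat_adjoint A *\<^sub>v w)"
    using A v w mult_mat_vec_carrier[OF mat_adjoint_carrier[OF A] w]
    by (simp add: cinner_eq_sum[where n = n] mult_mat_vec_index_sum[OF mat_adjoint_carrier]
        sum_distrib_left mult_ac del: index_mult_mat_vec)
  finally show ?thesis .
qed

lemma cinner_commute:
  fixes v w :: "complex vec"
  assumes "v \<in> carrier_vec n" "w \<in> carrier_vec n"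
  shows "w \<bullet>c v = cnj (v \<bullet>c w)"
  using assms by (simp add: cinner_eq_sum[where n = n] mult.commute)

lemma euclid_norm_sq:
  "v \<in> carrier_vec n \<Longrightarrow> (euclid_norm v)\<^sup>2 = (\<Sum>i<n. (cmod (v $ i))\<^sup>2)"
  by (simp add: euclid_norm_def sum_nonneg)

lemma euclid_norm_nonneg [simp]: "0 \<le> euclid_norm v"
  by (simp add: euclid_norm_def sum_nonneg)

lemma cinner_self:
  fixes v :: "complex vec"
  assumes "v \<in> carrier_vec n"
  shows "v \<bullet>c v = of_real ((euclid_norm v)\<^sup>2)"
  using assms by (simp only: euclid_norm_sq cinner_eq_sum of_real_sum complex_norm_square)

lemma euclid_norm_smult: "euclid_norm (c \<cdot>\<^sub>v v) = cmod c * euclid_norm v"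
proof -
  have "(\<Sum>i<dim_vec v. (cmod (c * v $ i))\<^sup>2) = (cmod c)\<^sup>2 * (\<Sum>i<dim_vec v. (cmod (v $ i))\<^sup>2)"
    by (simp add: norm_mult power_mult_distrib sum_distrib_left)
  then show ?thesis by (simp add: euclid_norm_def real_sqrt_mult)
qed

lemma euclid_norm_eq_0:
  assumes "v \<in> carrier_vec n"
  shows "euclid_norm v = 0 \<longleftrightarrow> v = 0\<^sub>v n"
proof -
  have "euclid_norm v = 0 \<longleftrightarrow> v \<bullet>c v = 0" using assms by (simp add: cinner_self)
  then show ?thesis using assms by simp
qed

text \<open>
  The scalar \<open>c\<close> is kept real: then the mixed term is a real part, which is what the positivity and
  coercivity estimates below compare.
\<close>

lemma euclid_norm_sq_diff:
  assumes u: "u \<in> carrier_vec n" and v: "v \<in> carrier_vec n"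
  shows "(euclid_norm (of_real c \<cdot>\<^sub>v u - v))\<^sup>2 =
    c\<^sup>2 * (euclid_norm u)\<^sup>2 - 2 * c * Re (v \<bullet>c u) + (euclid_norm v)\<^sup>2"
proof -
  have "(cmod (of_real c * a - b))\<^sup>2 = c\<^sup>2 * (cmod a)\<^sup>2 - 2 * c * Re (b * cnj a) + (cmod b)\<^sup>2"
    for a b :: complex
    unfolding cmod_power2 by (simp add: power2_eq_square algebra_simps)
  then show ?thesis using u v
    by (simp add: euclid_norm_sq[where n = n] cinner_eq_sum[where n = n] sum.distrib sum_subtractf
        sum_distrib_left distrib_left)
qed

lemma op_norm_bound:
  assumes A: "A \<in> carrier_mat m n" and v: "v \<in> carrier_vec n"
  shows "euclid_norm (A *\<^sub>v v) \<le> op_norm A * euclid_norm v"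
proof (cases "v = 0\<^sub>v n")
  case True
  then have "A *\<^sub>v v = 0\<^sub>v m" using A by auto
  then show ?thesis using euclid_norm_eq_0[of "0\<^sub>v m" m] by (simp add: op_norm_def True euclid_norm_def)
next
  case False
  let ?S = "{v \<in> carrier_vec n. euclid_norm v \<le> 1}"
  let ?b = "sqrt (\<Sum>i<m. (\<Sum>j<n. cmod (A $$ (i, j)))\<^sup>2)"
  \<comment> \<open>The supremum that defines \<open>op_norm A\<close> is over a bounded set: the entries of \<open>u\<close> are at most 1.\<close>
  have "euclid_norm (A *\<^sub>v u) \<le> ?b" if "u \<in> ?S" for u
  proof -
    have uc: "u \<in> carrier_vec n" and un: "euclid_norm u \<le> 1" using that by auto
    have "(cmod (u $ j))\<^sup>2 \<le> 1" if "j < n" for j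
    proof -
      have "(cmod (u $ j))\<^sup>2 \<le> (euclid_norm u)\<^sup>2"
        unfolding euclid_norm_sq[OF uc] using that by (intro member_le_sum) auto
      also have "\<dots> \<le> 1" using un by (simp add: power_le_one)
      finally show ?thesis .
    qed
    then have u1: "cmod (u $ j) \<le> 1" if "j < n" for j
      using that by (simp add: abs_square_le_1)
    have "cmod ((A *\<^sub>v u) $ i) \<le> (\<Sum>j<n. cmod (A $$ (i, j)))" if "i < m" for i
    proof -
      have "cmod ((A *\<^sub>v u) $ i) \<le> (\<Sum>j<n. cmod (A $$ (i, j) * u $ j))"
        unfolding mult_mat_vec_index_sum[OF A uc that] by (rule norm_sum)
      also have "\<dots> \<le> (\<Sum>j<n. cmod (A $$ (i, j)))"
        using u1 by (intro sum_mono) (simp add: norm_mult mult_left_le)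
      finally show ?thesis .
    qed
    then show ?thesis
      unfolding euclid_norm_def using A
      by (intro real_sqrt_le_mono) (auto intro!: sum_mono power_mono simp del: index_mult_mat_vec)
  qed
  then have bdd: "bdd_above ((\<lambda>v. euclid_norm (A *\<^sub>v v)) ` ?S)" by (intro bdd_aboveI2)
  have pos: "euclid_norm v > 0" using False euclid_norm_eq_0[OF v] euclid_norm_nonneg[of v] by linarith
  define u where "u = complex_of_real (inverse (euclid_norm v)) \<cdot>\<^sub>v v"
  have "u \<in> ?S" using v pos by (simp add: u_def euclid_norm_smult norm_inverse)
  then have "euclid_norm (A *\<^sub>v u) \<le> op_norm A"
    unfolding op_norm_def using A by (intro cSUP_upper2[OF _ _ order_refl]) (auto simp: bdd)
  moreover have "A *\<^sub>v u = of_real (inverse (euclid_norm v)) \<cdot>\<^sub>v (A *\<^sub>v v)"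
    unfolding u_def using A v by (rule mult_mat_vec)
  ultimately show ?thesis using pos by (simp add: euclid_norm_smult norm_inverse norm_divide field_simps)
qed

lemma op_norm_leI:
  assumes "A \<in> carrier_mat m n" "0 \<le> c"
    and "\<And>v. v \<in> carrier_vec n \<Longrightarrow> euclid_norm (A *\<^sub>v v) \<le> c * euclid_norm v"
  shows "op_norm A \<le> c"
  unfolding op_norm_def
proof (rule cSUP_least)
  have "0\<^sub>v n \<in> {v \<in> carrier_vec (dim_col A). euclid_norm v \<le> 1}" using assms(1) by (simp add: euclid_norm_def)
  then show "{v \<in> carrier_vec (dim_col A). euclid_norm v \<le> 1} \<noteq> {}" using assms(1) by blast
  fix v assume "v \<in> {v \<in> carrier_vec (dim_col A). euclid_norm v \<le> 1}"
  then have "v \<in> carrier_vec n" and "euclid_norm v \<le> 1" using assms(1) by auto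
  then show "euclid_norm (A *\<^sub>v v) \<le> c"
    using assms(3)[of v] mult_left_le[OF \<open>euclid_norm v \<le> 1\<close> \<open>0 \<le> c\<close>] by linarith
qed

lemma hermitian_form_real:
  assumes M: "M \<in> hermitian_mats n" and v: "v \<in> carrier_vec n"
  shows "Im ((M *\<^sub>v v) \<bullet>c v) = 0"
proof -
  have Mc: "M \<in> carrier_mat n n" and adj: "mat_adjoint M = M"
    using M by (auto simp: hermitian_mats_def)
  have "(M *\<^sub>v v) \<bullet>c v = v \<bullet>c (M *\<^sub>v v)" using cinner_adjoint[OF Mc v v] adj by simp
  also have "\<dots> = cnj ((M *\<^sub>v v) \<bullet>c v)"
    by (rule cinner_commute[OF mult_mat_vec_carrier[OF Mc v] v])
  finally show ?thesis by (simp add: complex_eq_iff)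
qed

lemma psd_iff_Re:
  assumes "M \<in> carrier_mat n n"
  shows "psd M \<longleftrightarrow> M \<in> hermitian_mats n \<and> (\<forall>v\<in>carrier_vec n. 0 \<le> Re ((M *\<^sub>v v) \<bullet>c v))"
  using assms hermitian_form_real[of M n] by (auto simp: psd_def less_eq_complex_def)

lemma cinner_diff_diff:
  fixes t :: real and a b u v :: "complex vec"
  assumes "a \<in> carrier_vec n" "b \<in> carrier_vec n" "u \<in> carrier_vec n" "v \<in> carrier_vec n"
  shows "(a - of_real t \<cdot>\<^sub>v b) \<bullet>c (v - of_real t \<cdot>\<^sub>v u) =
    a \<bullet>c v - of_real t * (a \<bullet>c u) - of_real t * (b \<bullet>c v) + of_real (t\<^sup>2) * (b \<bullet>c u)"
proof -
  have "v - of_real t \<cdot>\<^sub>v u \<in> carrier_vec n" using assms by simp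
  then show ?thesis
    unfolding cinner_eq_sum[OF assms(3)] cinner_eq_sum[OF assms(4)] sum_distrib_left
      cinner_eq_sum[OF \<open>v - of_real t \<cdot>\<^sub>v u \<in> carrier_vec n\<close>]
      sum.distrib[symmetric] sum_subtractf[symmetric]
    using assms by (intro sum.cong) (auto simp: algebra_simps power2_eq_square)
qed

text \<open>
  A positive semidefinite matrix without kernel is bounded below. With an inverse \<open>N\<close> of \<open>M\<close>, the
  inequality \<open>0 \<le> \<langle>M (v - t N v), v - t N v\<rangle> = \<langle>M v, v\<rangle> - 2 t \<parallel>v\<parallel>\<^sup>2 + t\<^sup>2 \<langle>v, N v\<rangle>\<close> for a small fixed
  \<open>t\<close> replaces compactness of the unit sphere and the spectral theorem.
\<close>

lemma coercive_of_trivial_kernel: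
  assumes M: "M \<in> hermitian_mats n"
    and nonneg: "\<And>v. v \<in> carrier_vec n \<Longrightarrow> 0 \<le> Re ((M *\<^sub>v v) \<bullet>c v)"
    and ker: "\<And>v. v \<in> carrier_vec n \<Longrightarrow> M *\<^sub>v v = 0\<^sub>v n \<Longrightarrow> v = 0\<^sub>v n"
  shows "\<exists>e>0. \<forall>v\<in>carrier_vec n. e * (euclid_norm v)\<^sup>2 \<le> Re ((M *\<^sub>v v) \<bullet>c v)"
proof -
  have Mc: "M \<in> carrier_mat n n" and adj: "mat_adjoint M = M"
    using M by (auto simp: hermitian_mats_def)
  have "det M \<noteq> 0" using det_0_iff_vec_prod_zero_field[OF Mc] ker by blast
  then have "M \<in> Units (ring_mat TYPE(complex) n ())" by (rule det_non_zero_imp_unit[OF Mc])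
  then obtain N where N: "N \<in> carrier_mat n n" and MN: "M * N = 1\<^sub>m n"
    by (auto simp: Units_def ring_mat_def)
  \<comment> \<open>\<open>K\<close> bounds \<open>\<langle>v, N v\<rangle> / \<parallel>v\<parallel>\<^sup>2\<close>, by \<open>2 Re \<langle>v, u\<rangle> \<le> \<parallel>v\<parallel>\<^sup>2 + \<parallel>u\<parallel>\<^sup>2\<close>; then \<open>t = 1 / K\<close> is optimal.\<close>
  define K where "K = (1 + (op_norm N)\<^sup>2) / 2"
  have K: "K > 0" by (simp add: K_def add_pos_nonneg)
  have "1 / K * (euclid_norm v)\<^sup>2 \<le> Re ((M *\<^sub>v v) \<bullet>c v)" if v: "v \<in> carrier_vec n" for v
  proof -
    let ?u = "N *\<^sub>v v" and ?t = "1 / K"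
    have u: "?u \<in> carrier_vec n" using N v by (rule mult_mat_vec_carrier)
    have Mv: "M *\<^sub>v v \<in> carrier_vec n" using Mc v by (rule mult_mat_vec_carrier)
    have Mu: "M *\<^sub>v ?u = v" using assoc_mult_mat_vec[OF Mc N v] MN v by simp
    have "2 * Re (v \<bullet>c ?u) \<le> (euclid_norm v)\<^sup>2 + (euclid_norm ?u)\<^sup>2"
      using euclid_norm_sq_diff[OF u v, of 1] zero_le_power2[of "euclid_norm (of_real 1 \<cdot>\<^sub>v ?u - v)"]
      by simp
    also have "(euclid_norm ?u)\<^sup>2 \<le> (op_norm N * euclid_norm v)\<^sup>2"
      using op_norm_bound[OF N v] by (intro power_mono) auto
    finally have vu: "Re (v \<bullet>c ?u) \<le> K * (euclid_norm v)\<^sup>2"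
      by (simp add: K_def power_mult_distrib algebra_simps)
    have "0 \<le> Re ((M *\<^sub>v (v - of_real ?t \<cdot>\<^sub>v ?u)) \<bullet>c (v - of_real ?t \<cdot>\<^sub>v ?u))"
      using u v by (intro nonneg) simp
    also have "M *\<^sub>v (v - of_real ?t \<cdot>\<^sub>v ?u) = M *\<^sub>v v - of_real ?t \<cdot>\<^sub>v v"
      using u v Mu by (simp add: mult_minus_distrib_mat_vec[OF Mc] mult_mat_vec[OF Mc])
    also have "(M *\<^sub>v v - of_real ?t \<cdot>\<^sub>v v) \<bullet>c (v - of_real ?t \<cdot>\<^sub>v ?u) =
        (M *\<^sub>v v) \<bullet>c v - of_real ?t * ((M *\<^sub>v v) \<bullet>c ?u) - of_real ?t * (v \<bullet>c v)
        + of_real (?t\<^sup>2) * (v \<bullet>c ?u)"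
      by (rule cinner_diff_diff[OF Mv v u v])
    also have "(M *\<^sub>v v) \<bullet>c ?u = v \<bullet>c v" using cinner_adjoint[OF Mc v u] adj Mu by simp
    also have "Re ((M *\<^sub>v v) \<bullet>c v - of_real ?t * (v \<bullet>c v) - of_real ?t * (v \<bullet>c v)
        + of_real (?t\<^sup>2) * (v \<bullet>c ?u)) =
      Re ((M *\<^sub>v v) \<bullet>c v) - 2 * ?t * (euclid_norm v)\<^sup>2 + ?t\<^sup>2 * Re (v \<bullet>c ?u)"
      by (simp add: cinner_self[OF v] del: of_real_power of_real_divide)
    also have "?t\<^sup>2 * Re (v \<bullet>c ?u) \<le> ?t\<^sup>2 * (K * (euclid_norm v)\<^sup>2)"
      using vu by (intro mult_left_mono) auto
    also have "?t\<^sup>2 * (K * (euclid_norm v)\<^sup>2) = ?t * (euclid_norm v)\<^sup>2"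
      using K by (simp add: power2_eq_square)
    finally show ?thesis by simp
  qed
  then show ?thesis using K by (intro exI[of _ "1 / K"]) auto
qed

section \<open>From isometries to positive maps\<close>

definition outer :: "complex vec \<Rightarrow> complex mat" where
  "outer x = mat (dim_vec x) (dim_vec x) (\<lambda>(a, b). x $ a * cnj (x $ b))"

lemma outer_carrier [simp]: "x \<in> carrier_vec n \<Longrightarrow> outer x \<in> carrier_mat n n"
  by (simp add: outer_def)

lemma outer_mult_vec:
  assumes x: "x \<in> carrier_vec n" and v: "v \<in> carrier_vec n"
  shows "outer x *\<^sub>v v = (v \<bullet>c x) \<cdot>\<^sub>v x"
proof (rule eq_vecI)
  fix i assume "i < dim_vec ((v \<bullet>c x) \<cdot>\<^sub>v x)"
  then have i: "i < n" using x by simp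
  then show "(outer x *\<^sub>v v) $ i = ((v \<bullet>c x) \<cdot>\<^sub>v x) $ i"
    unfolding mult_mat_vec_index_sum[OF outer_carrier[OF x] v i]
    using x v by (simp add: outer_def cinner_eq_sum[where n = n] sum_distrib_left mult_ac del: index_mult_mat_vec)
qed (use x in \<open>simp add: outer_def\<close>)

lemma smult_mat_mult_vec: "dim_vec v = dim_col A \<Longrightarrow> (c \<cdot>\<^sub>m A) *\<^sub>v v = c \<cdot>\<^sub>v (A *\<^sub>v v)"
  for c :: complex
  by (intro eq_vecI) (auto simp: scalar_prod_def sum_distrib_left mult_ac)

lemma mat_diff_eq_add_smult: "A - B = A + (- 1) \<cdot>\<^sub>m B" 
  if "A \<in> carrier_mat m n" "B \<in> carrier_mat m n" for A B :: "complex mat"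
  using that by (intro eq_matI) auto

text \<open>
  With \<open>c = \<parallel>x\<parallel>\<^sup>2\<close>, the matrix \<open>c I - x x*\<close> is \<open>c\<close> times an orthogonal projection. An isometry keeps
  this norm, and the norm bound on the image is what encodes positivity of \<open>\<phi>(x x*)\<close>.
\<close>

lemma op_norm_outer_complement:
  assumes x: "x \<in> carrier_vec n"
  shows "op_norm (of_real ((euclid_norm x)\<^sup>2) \<cdot>\<^sub>m 1\<^sub>m n - outer x) \<le> (euclid_norm x)\<^sup>2"
proof (rule op_norm_leI[where m = n and n = n])
  let ?c = "(euclid_norm x)\<^sup>2"
  fix v :: "complex vec" assume v: "v \<in> carrier_vec n"
  have "(euclid_norm (of_real ?c \<cdot>\<^sub>v v - (v \<bullet>c x) \<cdot>\<^sub>v x))\<^sup>2 =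
      ?c\<^sup>2 * (euclid_norm v)\<^sup>2 - 2 * ?c * Re (((v \<bullet>c x) \<cdot>\<^sub>v x) \<bullet>c v) + (cmod (v \<bullet>c x))\<^sup>2 * ?c"
    using x v by (simp add: euclid_norm_sq_diff euclid_norm_smult power_mult_distrib del: of_real_power)
  also have "((v \<bullet>c x) \<cdot>\<^sub>v x) \<bullet>c v = (v \<bullet>c x) * cnj (v \<bullet>c x)"
    using x v cinner_commute[OF v x] by simp
  also have "\<dots> = of_real ((cmod (v \<bullet>c x))\<^sup>2)" by (simp only: complex_norm_square)
  also have "Re \<dots> = (cmod (v \<bullet>c x))\<^sup>2" by simp
  also have "?c\<^sup>2 * (euclid_norm v)\<^sup>2 - 2 * ?c * (cmod (v \<bullet>c x))\<^sup>2 + (cmod (v \<bullet>c x))\<^sup>2 * ?c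
      = (?c * euclid_norm v)\<^sup>2 - ?c * (cmod (v \<bullet>c x))\<^sup>2"
    by (simp add: power_mult_distrib)
  also have "\<dots> \<le> (?c * euclid_norm v)\<^sup>2" by simp
  finally have "euclid_norm (of_real ?c \<cdot>\<^sub>v v - (v \<bullet>c x) \<cdot>\<^sub>v x) \<le> ?c * euclid_norm v"
    by (rule power2_le_imp_le) simp
  moreover have "(of_real ?c \<cdot>\<^sub>m 1\<^sub>m n - outer x) *\<^sub>v v = of_real ?c \<cdot>\<^sub>v v - (v \<bullet>c x) \<cdot>\<^sub>v x"
    using x v by (simp add: minus_mult_distrib_mat_vec[where nr = n and nc = n] outer_mult_vec
        smult_mat_mult_vec del: of_real_power)
  ultimately show "euclid_norm ((of_real ?c \<cdot>\<^sub>m 1\<^sub>m n - outer x) *\<^sub>v v) \<le> ?c * euclid_norm v"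
    by simp
qed (use x in \<open>auto intro!: minus_carrier_mat\<close>)


text \<open>
  Positivity is recorded on rank one matrices and in a quantitative form: the last assumption says
  that \<open>B = \<phi>(x x*)\<close> satisfies \<open>B\<^sup>2 \<le> 2 \<parallel>x\<parallel>\<^sup>2 B\<close>. This gives at once that \<open>B\<close> is positive semidefinite
  and that a vector on which its quadratic form vanishes lies in its kernel.
\<close>

locale unital_positive_map =
  fixes d r :: nat and \<phi> :: "complex mat \<Rightarrow> complex mat"
  assumes maps: "\<phi> \<in> carrier_mat d d \<rightarrow> carrier_mat r r"
    and add: "\<forall>A\<in>carrier_mat d d. \<forall>B\<in>carrier_mat d d. \<phi> (A + B) = \<phi> A + \<phi> B"
    and smult: "\<forall>c. \<forall>A\<in>carrier_mat d d. \<phi> (c \<cdot>\<^sub>m A) = c \<cdot>\<^sub>m \<phi> A"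
    and adjoint: "A \<in> carrier_mat d d \<Longrightarrow> \<phi> (mat_adjoint A) = mat_adjoint (\<phi> A)"
    and unital: "\<phi> (1\<^sub>m d) = 1\<^sub>m r"
    and outer_bound: "x \<in> carrier_vec d \<Longrightarrow> w \<in> carrier_vec r \<Longrightarrow>
      (euclid_norm (\<phi> (outer x) *\<^sub>v w))\<^sup>2 \<le>
        2 * (euclid_norm x)\<^sup>2 * Re ((\<phi> (outer x) *\<^sub>v w) \<bullet>c w)"

text \<open>
  With \<open>c = \<parallel>x\<parallel>\<^sup>2\<close> and \<open>B = \<phi>(x x*)\<close>, the isometry property gives \<open>\<parallel>c w - B w\<parallel> \<le> c \<parallel>w\<parallel>\<close>. Expanding the
  squares leaves the bound on \<open>\<parallel>B w\<parallel>\<^sup>2\<close>.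
\<close>

lemma unital_star_isometry_imp_positive:
  assumes "unital_star_isometry d r \<phi>"
  shows "unital_positive_map d r \<phi>"
proof
  have maps: "\<phi> \<in> carrier_mat d d \<rightarrow> carrier_mat r r"
    and add: "\<forall>A\<in>carrier_mat d d. \<forall>B\<in>carrier_mat d d. \<phi> (A + B) = \<phi> A + \<phi> B"
    and smult: "\<forall>c. \<forall>A\<in>carrier_mat d d. \<phi> (c \<cdot>\<^sub>m A) = c \<cdot>\<^sub>m \<phi> A"
    and unital: "\<phi> (1\<^sub>m d) = 1\<^sub>m r"
    and isom: "\<forall>A\<in>carrier_mat d d. op_norm (\<phi> A) = op_norm A"
    using assms by (auto simp: unital_star_isometry_def)
  fix x w :: "complex vec" assume x: "x \<in> carrier_vec d" and w: "w \<in> carrier_vec r"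
  let ?c = "(euclid_norm x)\<^sup>2" and ?B = "\<phi> (outer x)"
  let ?D = "of_real ?c \<cdot>\<^sub>m 1\<^sub>m d - outer x"
  have B: "?B \<in> carrier_mat r r" using maps outer_carrier[OF x] by auto
  have D: "?D \<in> carrier_mat d d" using x by (intro minus_carrier_mat) simp
  have "?D = of_real ?c \<cdot>\<^sub>m 1\<^sub>m d + (- 1) \<cdot>\<^sub>m outer x"
    using x by (intro mat_diff_eq_add_smult[where m = d and n = d]) auto
  then have "\<phi> ?D = of_real ?c \<cdot>\<^sub>m 1\<^sub>m r + (- 1) \<cdot>\<^sub>m ?B"
    using add smult unital x by (simp del: of_real_power)
  also have "\<dots> = of_real ?c \<cdot>\<^sub>m 1\<^sub>m r - ?B"
    using B by (intro mat_diff_eq_add_smult[symmetric, where m = r and n = r]) auto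
  finally have eq: "\<phi> ?D = of_real ?c \<cdot>\<^sub>m 1\<^sub>m r - ?B" .
  have "\<phi> ?D *\<^sub>v w = of_real ?c \<cdot>\<^sub>v w - ?B *\<^sub>v w"
    unfolding eq using B w
    by (simp add: minus_mult_distrib_mat_vec[where nr = r and nc = r] smult_mat_mult_vec
        del: of_real_power)
  moreover have "euclid_norm (\<phi> ?D *\<^sub>v w) \<le> ?c * euclid_norm w"
  proof -
    have "euclid_norm (\<phi> ?D *\<^sub>v w) \<le> op_norm (\<phi> ?D) * euclid_norm w"
      using maps D w by (intro op_norm_bound[where m = r and n = r]) auto
    also have "op_norm (\<phi> ?D) = op_norm ?D" using isom D by blast
    also have "op_norm ?D * euclid_norm w \<le> ?c * euclid_norm w"
      using op_norm_outer_complement[OF x] by (intro mult_right_mono) auto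
    finally show ?thesis .
  qed
  ultimately have "(euclid_norm (of_real ?c \<cdot>\<^sub>v w - ?B *\<^sub>v w))\<^sup>2 \<le> (?c * euclid_norm w)\<^sup>2"
    by (intro power_mono) (auto simp del: of_real_power)
  then show "(euclid_norm (?B *\<^sub>v w))\<^sup>2 \<le> 2 * ?c * Re ((?B *\<^sub>v w) \<bullet>c w)"
    unfolding euclid_norm_sq_diff[OF w mult_mat_vec_carrier[OF B w]]
    by (simp add: power_mult_distrib)
qed (use assms in \<open>auto simp: unital_star_isometry_def\<close>)

lemma matrix_unit_carrier [simp]: "matrix_unit d i j \<in> carrier_mat d d"
  by (simp add: matrix_unit_def)

lemma outer_transpose: "transpose_mat (outer x) = outer (conjugate x)"
  by (intro eq_matI) (auto simp: outer_def)

lemma euclid_norm_conjugate: "euclid_norm (conjugate x) = euclid_norm x"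
  by (simp add: euclid_norm_def)

lemma mat_adjoint_transpose:
  "A \<in> carrier_mat m n \<Longrightarrow> mat_adjoint (transpose_mat A) = transpose_mat (mat_adjoint A)"
  by (intro eq_matI) (auto simp: mat_adjoint_def mat_of_rows_index)

text \<open>
  Transposition sends \<open>x x*\<close> to \<open>y y*\<close> with \<open>y\<close> the complex conjugate of \<open>x\<close>, so it preserves
  positivity; this reduces the transposed alternatives of the theorem to the plain ones.
\<close>

lemma unital_positive_map_transpose:
  assumes "unital_positive_map d r \<phi>"
  shows "unital_positive_map d r (\<lambda>A. \<phi> (transpose_mat A))"
proof -
  interpret unital_positive_map d r \<phi> by fact
  show ?thesis
  proof
    fix x w :: "complex vec" assume "x \<in> carrier_vec d" "w \<in> carrier_vec r"
    then show "(euclid_norm (\<phi> (transpose_mat (outer x)) *\<^sub>v w))\<^sup>2 \<le>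
        2 * (euclid_norm x)\<^sup>2 * Re ((\<phi> (transpose_mat (outer x)) *\<^sub>v w) \<bullet>c w)"
      using outer_bound[of "conjugate x" w] by (simp add: outer_transpose euclid_norm_conjugate)
  next
    fix A :: "complex mat" assume A: "A \<in> carrier_mat d d"
    then show "\<phi> (transpose_mat (mat_adjoint A)) = mat_adjoint (\<phi> (transpose_mat A))"
      by (simp add: mat_adjoint_transpose[OF A, symmetric] adjoint)
  next
    show "\<forall>c. \<forall>A\<in>carrier_mat d d. \<phi> (transpose_mat (c \<cdot>\<^sub>m A)) = c \<cdot>\<^sub>m \<phi> (transpose_mat A)"
    proof (intro allI ballI)
      fix c and A :: "complex mat" assume A: "A \<in> carrier_mat d d"
      have "transpose_mat (c \<cdot>\<^sub>m A) = c \<cdot>\<^sub>m transpose_mat A" by (intro eq_matI) auto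
      then show "\<phi> (transpose_mat (c \<cdot>\<^sub>m A)) = c \<cdot>\<^sub>m \<phi> (transpose_mat A)"
        using A smult by simp
    qed
  next
    show "\<forall>A\<in>carrier_mat d d. \<forall>B\<in>carrier_mat d d.
        \<phi> (transpose_mat (A + B)) = \<phi> (transpose_mat A) + \<phi> (transpose_mat B)"
      using add by (simp add: transpose_add)
  qed (use maps unital in auto)
qed

lemma sum_nat_product:
  fixes f :: "nat \<Rightarrow> 'a :: comm_monoid_add"
  shows "(\<Sum>i<s * n. f i) = (\<Sum>k<s. \<Sum>a<n. f (k * n + a))"
proof -
  have "(\<Sum>i<s * n. f i) = (\<Sum>k<s. sum f {k * n..<k * n + n})" by (simp add: sum.nat_group)
  moreover have "sum f {k * n..<k * n + n} = (\<Sum>a<n. f (k * n + a))" for k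
    using sum.shift_bounds_nat_ivl[of f 0 "k * n" n] by (simp add: lessThan_atLeast0 add.commute)
  ultimately show ?thesis by simp
qed

context unital_positive_map
begin

abbreviation image_unit :: "nat \<Rightarrow> nat \<Rightarrow> complex mat" where
  "image_unit i j \<equiv> \<phi> (matrix_unit d i j)"

lemma map_carrier [simp]: "A \<in> carrier_mat d d \<Longrightarrow> \<phi> A \<in> carrier_mat r r"
  using maps by auto

lemma image_unit_adjoint: "mat_adjoint (image_unit i j) = image_unit j i"
proof -
  have "mat_adjoint (matrix_unit d i j) = matrix_unit d j i"
  proof (rule eq_matI)
    fix a b assume "a < dim_row (matrix_unit d j i)" "b < dim_col (matrix_unit d j i)"
    then have "a < d" "b < d" by (auto simp: matrix_unit_def)
    then show "mat_adjoint (matrix_unit d i j) $$ (a, b) = matrix_unit d j i $$ (a, b)"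
      unfolding mat_adjoint_index[OF matrix_unit_carrier \<open>a < d\<close> \<open>b < d\<close>]
      by (auto simp: matrix_unit_def)
  qed (auto simp: matrix_unit_def mat_adjoint_def)
  then show ?thesis using adjoint[OF matrix_unit_carrier] by metis
qed

lemma map_expand:
  assumes A: "A \<in> carrier_mat d d"
  shows "\<phi> A = mat r r (\<lambda>ab. \<Sum>i<d. \<Sum>j<d. A $$ (i, j) * image_unit i j $$ ab)"
proof -
  let ?Y = "\<lambda>k. matrix_unit d (k div d) (k mod d)" and ?c = "\<lambda>k. A $$ (k div d, k mod d)"
  let ?S = "mat d d (\<lambda>ab. \<Sum>k<d * d. ?c k * ?Y k $$ ab)"
  have S: "A = ?S"
  proof (rule eq_matI; simp)
    fix a b assume ab: "a < d" "b < d"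
    have "(\<Sum>k<d * d. ?c k * ?Y k $$ (a, b)) =
        (\<Sum>i<d. \<Sum>j<d. if j = b then if i = a then A $$ (i, j) else 0 else 0)"
      unfolding sum_nat_product using ab
      by (intro sum.cong) (auto simp: matrix_unit_def)
    also have "\<dots> = A $$ (a, b)" using ab by simp
    finally show "A $$ (a, b) = (\<Sum>k<d * d. ?c k * ?Y k $$ (a, b))" ..
  qed (use A in auto)
  have "\<phi> A = \<phi> ?S" using S by (rule arg_cong)
  also have "\<dots> = mat r r (\<lambda>ab. \<Sum>k<d * d. ?c k * \<phi> (?Y k) $$ ab)"
    by (rule linear_mat_sum[OF maps add smult]) simp
  also have "\<dots> = mat r r (\<lambda>ab. \<Sum>i<d. \<Sum>j<d. A $$ (i, j) * image_unit i j $$ ab)"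
    unfolding sum_nat_product by (intro eq_matI) auto
  finally show ?thesis .
qed

lemma map_mult_vec_expand:
  assumes A: "A \<in> carrier_mat d d" and w: "w \<in> carrier_vec r" and a: "a < r"
  shows "(\<phi> A *\<^sub>v w) $ a = (\<Sum>i<d. \<Sum>j<d. A $$ (i, j) * (image_unit i j *\<^sub>v w) $ a)"
proof -
  have "(\<phi> A *\<^sub>v w) $ a = (\<Sum>b<r. \<Sum>i<d. \<Sum>j<d. A $$ (i, j) * image_unit i j $$ (a, b) * w $ b)"
    unfolding mult_mat_vec_index_sum[OF map_carrier[OF A] w a]
    by (subst map_expand[OF A]) (simp add: a sum_distrib_right)
  also have "\<dots> = (\<Sum>i<d. \<Sum>b<r. \<Sum>j<d. A $$ (i, j) * image_unit i j $$ (a, b) * w $ b)"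
    by (rule sum.swap)
  also have "\<dots> = (\<Sum>i<d. \<Sum>j<d. \<Sum>b<r. A $$ (i, j) * image_unit i j $$ (a, b) * w $ b)"
    by (intro sum.cong sum.swap refl)
  also have "\<dots> = (\<Sum>i<d. \<Sum>j<d. A $$ (i, j) * (image_unit i j *\<^sub>v w) $ a)"
    by (simp only: mult_mat_vec_index_sum[OF map_carrier[OF matrix_unit_carrier] w a]
        sum_distrib_left mult.assoc)
  finally show ?thesis .
qed

lemma outer_form_nonneg:
  assumes "x \<in> carrier_vec d" "w \<in> carrier_vec r"
  shows "0 \<le> Re ((\<phi> (outer x) *\<^sub>v w) \<bullet>c w)"
proof (cases "x = 0\<^sub>v d")
  case True
  then have "(\<phi> (outer x) *\<^sub>v w) $ a = 0" if "a < r" for a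
    using map_mult_vec_expand[OF outer_carrier[OF assms(1)] assms(2) that]
    by (simp add: outer_def)
  then show ?thesis using assms(2) by (simp add: cinner_eq_sum[of _ r] del: index_mult_mat_vec)
next
  case False
  then have "0 < (euclid_norm x)\<^sup>2" using euclid_norm_eq_0[OF assms(1)] by simp
  moreover have "0 \<le> 2 * (euclid_norm x)\<^sup>2 * Re ((\<phi> (outer x) *\<^sub>v w) \<bullet>c w)"
    using outer_bound[OF assms] by (rule order_trans[rotated]) simp
  ultimately show ?thesis by (simp add: zero_le_mult_iff)
qed

lemma outer_form_zero_imp_kernel:
  assumes "x \<in> carrier_vec d" "w \<in> carrier_vec r" "Re ((\<phi> (outer x) *\<^sub>v w) \<bullet>c w) = 0"
  shows "\<phi> (outer x) *\<^sub>v w = 0\<^sub>v r"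
proof -
  have "euclid_norm (\<phi> (outer x) *\<^sub>v w) = 0" using outer_bound[OF assms(1,2)] assms(3) by simp
  moreover have "\<phi> (outer x) *\<^sub>v w \<in> carrier_vec r"
    using assms(1,2) by (intro mult_mat_vec_carrier[of _ r r]) auto
  ultimately show ?thesis by (simp add: euclid_norm_eq_0)
qed

lemma sum_image_units:
  assumes w: "w \<in> carrier_vec r" and a: "a < r"
  shows "(\<Sum>i<d. (image_unit i i *\<^sub>v w) $ a) = w $ a"
proof -
  have "w $ a = (\<phi> (1\<^sub>m d) *\<^sub>v w) $ a" using w by (simp add: unital)
  also have "\<dots> = (\<Sum>i<d. \<Sum>j<d. if j = i then (image_unit i j *\<^sub>v w) $ a else 0)"
    unfolding map_mult_vec_expand[OF one_carrier_mat w a]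
    by (intro sum.cong) auto
  finally show ?thesis by simp
qed

end


section \<open>The trace inequality for positive maps and its case of equality\<close>

lemma sum_off_diagonal:
  fixes f :: "nat \<Rightarrow> nat \<Rightarrow> 'a :: ab_group_add"
  shows "(\<Sum>i<d. \<Sum>j\<in>{..<d} - {i}. f i j) = (\<Sum>i<d. \<Sum>j<d. f i j) - (\<Sum>i<d. f i i)"
proof -
  have "(\<Sum>j\<in>{..<d} - {i}. f i j) = (\<Sum>j<d. f i j) - f i i" if "i < d" for i
    using that by (simp add: sum_diff1)
  then show ?thesis by (simp add: sum_subtractf)
qed

lemma outer_index:
  "x \<in> carrier_vec n \<Longrightarrow> k < n \<Longrightarrow> l < n \<Longrightarrow> outer x $$ (k, l) = x $ k * cnj (x $ l)"
  by (simp add: outer_def)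

text \<open>
  The vector \<open>e\<^sub>i + z e\<^sub>j\<close>. Paired with \<open>v\<^sub>i - z v\<^sub>j\<close> for a unimodular \<open>z\<close>, it tests positivity on
  rank one matrices that mix two coordinates.
\<close>

definition probe :: "nat \<Rightarrow> nat \<Rightarrow> nat \<Rightarrow> complex \<Rightarrow> complex vec" where
  "probe d i j z = unit_vec d i + z \<cdot>\<^sub>v unit_vec d j"

lemma probe_carrier [simp]: "probe d i j z \<in> carrier_vec d"
  by (simp add: probe_def)

lemma probe_index:
  "k < d \<Longrightarrow> probe d i j z $ k = (if k = i then 1 else 0) + z * (if k = j then 1 else 0)"
  by (auto simp: probe_def unit_vec_def)

lemma sum_probe:
  assumes "i < d" "j < d"
  shows "(\<Sum>k<d. probe d i j z $ k * f k) = f i + z * f j"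
    and "(\<Sum>k<d. cnj (probe d i j z $ k) * f k) = f i + cnj z * f j"
proof -
  have "(\<Sum>k<d. probe d i j z $ k * f k) =
      (\<Sum>k<d. (if k = i then f k else 0) + z * (if k = j then f k else 0))"
    by (intro sum.cong) (auto simp: probe_index distrib_right)
  also have "\<dots> = f i + z * f j"
    using assms by (simp add: sum.distrib flip: sum_distrib_left)
  finally show "(\<Sum>k<d. probe d i j z $ k * f k) = f i + z * f j" .
  have "(\<Sum>k<d. cnj (probe d i j z $ k) * f k) =
      (\<Sum>k<d. (if k = i then f k else 0) + cnj z * (if k = j then f k else 0))"
    by (intro sum.cong) (auto simp: probe_index distrib_right)
  also have "\<dots> = f i + cnj z * f j"
    using assms by (simp add: sum.distrib flip: sum_distrib_left)
  finally show "(\<Sum>k<d. cnj (probe d i j z $ k) * f k) = f i + cnj z * f j" .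
qed

text \<open>
  Averaging over these four numbers annihilates \<open>z\<^sup>m\<close> unless 4 divides \<open>m\<close>. The exponents that occur
  below lie between -2 and 2, so the average extracts the constant term.
\<close>

definition fourth_roots :: "complex set" where
  "fourth_roots = {1, - 1, \<i>, - \<i>}"

lemma sum_fourth_roots: "(\<Sum>z\<in>fourth_roots. f z) = f 1 + f (- 1) + f \<i> + f (- \<i>)"
  by (simp add: fourth_roots_def complex_eq_iff add.assoc)

context unital_positive_map
begin

lemma image_unit_mult_carrier [simp]:
  "w \<in> carrier_vec r \<Longrightarrow> image_unit i j *\<^sub>v w \<in> carrier_vec r"
  using mult_mat_vec_carrier[OF map_carrier[OF matrix_unit_carrier]] .

lemma dim_row_image_unit [simp]: "dim_row (image_unit i j) = r"
  by (rule carrier_matD(1)[OF map_carrier[OF matrix_unit_carrier]])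

text \<open>
  For unimodular \<open>z\<close>, \<open>(e\<^sub>i + z e\<^sub>j) (e\<^sub>i + z e\<^sub>j)* = E\<^bsub>ii\<^esub> + E\<^bsub>jj\<^esub> + cnj z E\<^bsub>ij\<^esub> + z E\<^bsub>ji\<^esub>\<close>. The identity is stated in
  coordinates, so that later steps are identities between complex numbers.
\<close>

lemma outer_probe_mult_vec:
  assumes ij: "i < d" "j < d" and z: "z * cnj z = 1" and w: "w \<in> carrier_vec r" and a: "a < r"
  shows "(\<phi> (outer (probe d i j z)) *\<^sub>v w) $ a =
    (image_unit i i *\<^sub>v w) $ a + (image_unit j j *\<^sub>v w) $ a
    + cnj z * (image_unit i j *\<^sub>v w) $ a + z * (image_unit j i *\<^sub>v w) $ a"
proof -
  let ?P = "\<lambda>k l. (image_unit k l *\<^sub>v w) $ a"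
  have "(\<phi> (outer (probe d i j z)) *\<^sub>v w) $ a =
      (\<Sum>k<d. \<Sum>l<d. outer (probe d i j z) $$ (k, l) * ?P k l)"
    by (rule map_mult_vec_expand[OF outer_carrier[OF probe_carrier] w a])
  also have "\<dots> = (\<Sum>k<d. probe d i j z $ k * (\<Sum>l<d. cnj (probe d i j z $ l) * ?P k l))"
    by (simp add: outer_index[OF probe_carrier] sum_distrib_left mult.assoc
        del: index_mult_mat_vec)
  also have "\<dots> = ?P i i + cnj z * ?P i j + z * (?P j i + cnj z * ?P j j)"
    by (simp only: sum_probe[OF ij])
  also have "\<dots> = ?P i i + ?P j j + cnj z * ?P i j + z * ?P j i"
    using z by (simp add: algebra_simps del: index_mult_mat_vec)
  finally show ?thesis .
qed

lemma outer_unit_vec: "i < d \<Longrightarrow> outer (unit_vec d i) = matrix_unit d i i"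
  by (intro eq_matI) (auto simp: outer_def matrix_unit_def)

definition diag_term :: "(nat \<Rightarrow> complex vec) \<Rightarrow> nat \<Rightarrow> nat \<Rightarrow> complex" where
  "diag_term v i j = (image_unit i i *\<^sub>v v j) \<bullet>c v j"

definition cross_term :: "(nat \<Rightarrow> complex vec) \<Rightarrow> nat \<Rightarrow> nat \<Rightarrow> complex" where
  "cross_term v i j = (image_unit i j *\<^sub>v v j) \<bullet>c v i"

definition probe_term :: "(nat \<Rightarrow> complex vec) \<Rightarrow> nat \<Rightarrow> nat \<Rightarrow> complex \<Rightarrow> complex" where
  "probe_term v i j z =
    (\<phi> (outer (probe d i j z)) *\<^sub>v (v i - z \<cdot>\<^sub>v v j)) \<bullet>c (v i - z \<cdot>\<^sub>v v j)"

lemma image_unit_mult_diff: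
  assumes "u \<in> carrier_vec r" "w \<in> carrier_vec r" "a < r"
  shows "(image_unit k l *\<^sub>v (u - z \<cdot>\<^sub>v w)) $ a =
    (image_unit k l *\<^sub>v u) $ a - z * (image_unit k l *\<^sub>v w) $ a"
proof -
  have "image_unit k l *\<^sub>v (u - z \<cdot>\<^sub>v w) = image_unit k l *\<^sub>v u - z \<cdot>\<^sub>v (image_unit k l *\<^sub>v w)"
    using assms
    by (simp add: mult_minus_distrib_mat_vec[of _ r r] mult_mat_vec[of _ r r])
  then show ?thesis using assms
    by (simp del: index_mult_mat_vec)
qed

text \<open>
  Expanding \<open>\<langle>\<phi>(x x*) y, y\<rangle>\<close> at \<open>x = e\<^sub>i + z e\<^sub>j\<close>, \<open>y = v\<^sub>i - z v\<^sub>j\<close> gives a Laurent polynomial in \<open>z\<close>; only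
  its constant term survives the sum over the fourth roots of unity. The opposite signs of \<open>z\<close> in \<open>x\<close>
  and \<open>y\<close> are what makes the cross terms appear with a minus sign.
\<close>

lemma sum_probe_term:
  assumes ij: "i < d" "j < d" and v: "v i \<in> carrier_vec r" "v j \<in> carrier_vec r"
  shows "(\<Sum>z\<in>fourth_roots. probe_term v i j z) =
    4 * (diag_term v i i + diag_term v j i + diag_term v i j + diag_term v j j
      - cross_term v i j - cross_term v j i)"
proof -
  define P where "P k l b a = (image_unit k l *\<^sub>v v b) $ a" for k l b a
  have expand: "probe_term v i j z = (\<Sum>a<r.
      (P i i i a - z * P i i j a + (P j j i a - z * P j j j a)
        + cnj z * (P i j i a - z * P i j j a) + z * (P j i i a - z * P j i j a))
      * (cnj (v i $ a) - cnj z * cnj (v j $ a)))" if z: "z * cnj z = 1" for z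
  proof -
    have c: "v i - z \<cdot>\<^sub>v v j \<in> carrier_vec r" using v by simp
    show ?thesis
      unfolding probe_term_def cinner_eq_sum[OF c]
      using v by (intro sum.cong) (simp_all add: outer_probe_mult_vec[OF ij z c]
          image_unit_mult_diff P_def del: index_mult_mat_vec)
  qed
  have "(\<Sum>z\<in>fourth_roots. probe_term v i j z) = (\<Sum>a<r. 4 * (P i i i a * cnj (v i $ a)
      + P j j i a * cnj (v i $ a) + P i i j a * cnj (v j $ a) + P j j j a * cnj (v j $ a)
      - P i j j a * cnj (v i $ a) - P j i i a * cnj (v j $ a)))"
  proof -
    have roots: "1 * cnj 1 = 1" "- 1 * cnj (- 1) = 1" "\<i> * cnj \<i> = 1" "- \<i> * cnj (- \<i>) = 1"
      by simp_all
    show ?thesis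
      unfolding sum_fourth_roots expand[OF roots(1)] expand[OF roots(2)] expand[OF roots(3)]
        expand[OF roots(4)] sum.distrib[symmetric]
    proof (intro sum.cong refl, goal_cases)
      case (1 a)
      show ?case by (simp add: ring_distribs mult.assoc[symmetric])
    qed
  qed
  also have "\<dots> = 4 * (diag_term v i i + diag_term v j i + diag_term v i j + diag_term v j j
      - cross_term v i j - cross_term v j i)"
    unfolding diag_term_def cross_term_def cinner_eq_sum[OF v(1)] cinner_eq_sum[OF v(2)]
    by (simp add: P_def sum.distrib sum_subtractf sum_distrib_left algebra_simps
        del: index_mult_mat_vec)
  finally show ?thesis .
qed

lemma sum_diag_term:
  assumes "v k \<in> carrier_vec r"
  shows "(\<Sum>i<d. diag_term v i k) = v k \<bullet>c v k"
proof -
  have "(\<Sum>i<d. diag_term v i k) = (\<Sum>a<r. \<Sum>i<d. (image_unit i i *\<^sub>v v k) $ a * cnj (v k $ a))"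
    unfolding diag_term_def cinner_eq_sum[OF assms] by (rule sum.swap)
  also have "\<dots> = v k \<bullet>c v k"
    unfolding cinner_eq_sum[OF assms] sum_distrib_right[symmetric]
    by (intro sum.cong refl) (simp only: lessThan_iff sum_image_units[OF assms])
  finally show ?thesis .
qed

text \<open>
  The decomposition of \<open>d I - \<Omega>\<close> into products of rank one matrices, evaluated under \<open>\<phi>\<close>. The probes
  yield the cross terms with \<open>k \<noteq> l\<close> but count each diagonal term \<open>diag_term v i i\<close> only \<open>d - 1\<close> times
  and each \<open>diag_term v i j\<close> with \<open>i \<noteq> j\<close> once. One further copy of \<open>diag_term v i i\<close> cancels
  against \<open>cross_term v i i\<close>, and the first sum supplies the remaining mixed terms. Since unitality gives
  \<open>\<Sum>i. diag_term v i k = \<parallel>v\<^sub>k\<parallel>\<^sup>2\<close>, the total is \<open>d * \<Sum>k. \<parallel>v\<^sub>k\<parallel>\<^sup>2\<close>.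
\<close>

lemma defect_eq:
  assumes v: "\<And>k. k < d \<Longrightarrow> v k \<in> carrier_vec r"
  shows "of_nat d * (\<Sum>k<d. v k \<bullet>c v k) - (\<Sum>k<d. \<Sum>l<d. cross_term v k l) =
    (of_nat d - 1) * (\<Sum>i<d. \<Sum>j\<in>{..<d} - {i}. diag_term v i j)
    + (\<Sum>i<d. \<Sum>j\<in>{..<d} - {i}. \<Sum>z\<in>fourth_roots. probe_term v i j z) / 8"
proof -
  let ?G = "\<Sum>i<d. diag_term v i i" and ?T = "\<Sum>i<d. \<Sum>j<d. diag_term v i j"
  let ?R = "\<Sum>i<d. \<Sum>j<d. cross_term v i j"
  have "(\<Sum>i<d. \<Sum>j\<in>{..<d} - {i}. \<Sum>z\<in>fourth_roots. probe_term v i j z) =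
      (\<Sum>i<d. \<Sum>j\<in>{..<d} - {i}. 4 * (diag_term v i i + diag_term v j i + diag_term v i j
        + diag_term v j j - cross_term v i j - cross_term v j i))"
    using v by (intro sum.cong refl sum_probe_term) auto
  also have "\<dots> = 4 * (of_nat d * ?G + ?T + ?T + of_nat d * ?G - ?R - ?R)
      - 4 * (4 * ?G - 2 * (\<Sum>i<d. cross_term v i i))"
  proof -
    have "(\<Sum>i<d. \<Sum>j<d. diag_term v j i) = ?T" "(\<Sum>i<d. \<Sum>j<d. cross_term v j i) = ?R"
      by (rule sum.swap)+
    then show ?thesis
      unfolding sum_off_diagonal
      by (simp add: sum.distrib sum_subtractf flip: sum_distrib_left)
  qed
  also have "(\<Sum>i<d. cross_term v i i) = ?G" by (simp add: cross_term_def diag_term_def)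
  finally have probes: "(\<Sum>i<d. \<Sum>j\<in>{..<d} - {i}. \<Sum>z\<in>fourth_roots. probe_term v i j z) =
      4 * (of_nat d * ?G + ?T + ?T + of_nat d * ?G - ?R - ?R) - 4 * (4 * ?G - 2 * ?G)" .
  have "(\<Sum>k<d. v k \<bullet>c v k) = (\<Sum>k<d. \<Sum>i<d. diag_term v i k)"
    using v by (intro sum.cong) (simp_all add: sum_diag_term)
  also have "\<dots> = ?T" by (rule sum.swap)
  finally have norms: "(\<Sum>k<d. v k \<bullet>c v k) = ?T" .
  show ?thesis unfolding probes norms unfolding sum_off_diagonal by (simp add: field_simps)
qed

lemma diag_term_nonneg: "i < d \<Longrightarrow> v j \<in> carrier_vec r \<Longrightarrow> 0 \<le> Re (diag_term v i j)"
  using outer_form_nonneg[of "unit_vec d i" "v j"] by (simp add: diag_term_def outer_unit_vec)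

lemma probe_term_nonneg:
  "v i \<in> carrier_vec r \<Longrightarrow> v j \<in> carrier_vec r \<Longrightarrow> 0 \<le> Re (probe_term v i j z)"
  unfolding probe_term_def by (intro outer_form_nonneg) auto

lemma Re_defect_eq:
  assumes v: "\<And>k. k < d \<Longrightarrow> v k \<in> carrier_vec r"
  shows "Re (of_nat d * (\<Sum>k<d. v k \<bullet>c v k) - (\<Sum>k<d. \<Sum>l<d. cross_term v k l)) =
    (real d - 1) * (\<Sum>i<d. \<Sum>j\<in>{..<d} - {i}. Re (diag_term v i j))
    + (\<Sum>i<d. \<Sum>j\<in>{..<d} - {i}. \<Sum>z\<in>fourth_roots. Re (probe_term v i j z)) / 8"
  by (subst defect_eq) (simp_all add: v)

lemma Re_defect_nonneg:
  assumes v: "\<And>k. k < d \<Longrightarrow> v k \<in> carrier_vec r"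
  shows "0 \<le> Re (of_nat d * (\<Sum>k<d. v k \<bullet>c v k) - (\<Sum>k<d. \<Sum>l<d. cross_term v k l))"
proof (cases "d = 0")
  case False
  then show ?thesis using v
    by (subst Re_defect_eq) (auto simp: intro!: add_nonneg_nonneg mult_nonneg_nonneg sum_nonneg diag_term_nonneg probe_term_nonneg)
qed simp

text \<open>
  A vanishing sum of nonnegative terms has only zero terms. The weight \<open>d - 1\<close> is positive because
  there are two distinct indices.
\<close>

lemma defect_zero_imp_terms_zero:
  assumes v: "\<And>k. k < d \<Longrightarrow> v k \<in> carrier_vec r"
    and zero: "of_nat d * (\<Sum>k<d. v k \<bullet>c v k) = (\<Sum>k<d. \<Sum>l<d. cross_term v k l)"
    and ij: "i < d" "j < d" "i \<noteq> j"
  shows "Re (diag_term v i j) = 0"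
    and "z \<in> fourth_roots \<Longrightarrow> Re (probe_term v i j z) = 0"
proof -
  let ?D = "\<Sum>i<d. \<Sum>j\<in>{..<d} - {i}. Re (diag_term v i j)"
  let ?Q = "\<Sum>i<d. \<Sum>j\<in>{..<d} - {i}. \<Sum>z\<in>fourth_roots. Re (probe_term v i j z)"
  have fin: "finite fourth_roots" by (simp add: fourth_roots_def)
  have "(real d - 1) * ?D + ?Q / 8 = 0" using Re_defect_eq[of v] v zero by simp
  moreover have D: "0 \<le> ?D" and Q: "0 \<le> ?Q"
    using v by (auto intro!: sum_nonneg diag_term_nonneg probe_term_nonneg)
  moreover have "1 < real d" using ij by linarith
  ultimately have "?D = 0" "?Q = 0"
    by (smt (verit) mult_nonneg_nonneg mult_pos_pos divide_nonneg_nonneg divide_pos_pos)+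
  have "(\<Sum>j\<in>{..<d} - {i}. Re (diag_term v i j)) = 0"
    using \<open>?D = 0\<close> ij v
    by (subst (asm) sum_nonneg_eq_0_iff) (auto intro!: sum_nonneg diag_term_nonneg)
  then show "Re (diag_term v i j) = 0"
    using ij v by (subst (asm) sum_nonneg_eq_0_iff) (auto intro!: diag_term_nonneg)
  have "(\<Sum>j\<in>{..<d} - {i}. \<Sum>z\<in>fourth_roots. Re (probe_term v i j z)) = 0"
    using \<open>?Q = 0\<close> ij v
    by (subst (asm) sum_nonneg_eq_0_iff) (auto intro!: sum_nonneg probe_term_nonneg)
  then have "(\<Sum>z\<in>fourth_roots. Re (probe_term v i j z)) = 0"
    using ij v by (subst (asm) sum_nonneg_eq_0_iff) (auto intro!: sum_nonneg probe_term_nonneg)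
  then show "Re (probe_term v i j z) = 0" if "z \<in> fourth_roots"
    using ij v that fin by (subst (asm) sum_nonneg_eq_0_iff) (auto intro!: probe_term_nonneg)
qed

text \<open>
  In the case of equality, \<open>\<phi>(E\<^bsub>ii\<^esub>)\<close> kills \<open>v\<^sub>j\<close> for \<open>j \<noteq> i\<close>, hence fixes \<open>v\<^sub>i\<close> by unitality. The equations
  \<open>\<phi>(x x*) (v\<^sub>i - z v\<^sub>j) = 0\<close> involve the powers -1, 0, 1, 2 of \<open>z\<close>, which the fourth roots of unity
  separate; this settles \<open>s = i\<close> and \<open>s = j\<close>. For a third index \<open>s\<close>, the form of \<open>\<phi>(x x*)\<close> at \<open>v\<^sub>s\<close> is
  odd in \<open>z\<close> and nonnegative, hence zero.
\<close>

lemma defect_zero_imp_matrix_unit_action: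
  assumes v: "\<And>k. k < d \<Longrightarrow> v k \<in> carrier_vec r"
    and zero: "of_nat d * (\<Sum>k<d. v k \<bullet>c v k) = (\<Sum>k<d. \<Sum>l<d. cross_term v k l)"
    and ijs: "i < d" "j < d" "s < d"
  shows "image_unit i j *\<^sub>v v s = (if j = s then 1 else 0) \<cdot>\<^sub>v v i"
proof -
  note terms_zero = defect_zero_imp_terms_zero[OF v zero]
  have off: "(image_unit k k *\<^sub>v v l) $ a = 0" if "k < d" "l < d" "k \<noteq> l" "a < r" for k l a
  proof -
    have "image_unit k k *\<^sub>v v l = 0\<^sub>v r"
      using outer_form_zero_imp_kernel[of "unit_vec d k" "v l"] terms_zero(1)[of k l] that v
      by (simp add: outer_unit_vec diag_term_def)
    then show ?thesis using that by (simp del: index_mult_mat_vec)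
  qed
  have diag: "(image_unit k k *\<^sub>v v k) $ a = v k $ a" if "k < d" "a < r" for k a
  proof -
    have "v k $ a = (\<Sum>i<d. (image_unit i i *\<^sub>v v k) $ a)"
      using sum_image_units[OF v] that by simp
    also have "\<dots> = (\<Sum>i<d. if i = k then (image_unit i i *\<^sub>v v k) $ a else 0)"
      using off that by (intro sum.cong) auto
    finally show ?thesis using that by (simp del: index_mult_mat_vec)
  qed
  have root: "z * cnj z = 1" if "z \<in> fourth_roots" for z
    using that by (auto simp: fourth_roots_def)
  have "(image_unit i j *\<^sub>v v s) $ a = ((if j = s then 1 else 0) \<cdot>\<^sub>v v i) $ a" if a: "a < r" for a
  proof (cases "i = j")
    case True
    then show ?thesis using ijs diag off a v[of s] carrier_vecD[OF v] by (auto simp del: index_mult_mat_vec)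
  next
    case ne: False
    consider "s = j" | "s = i" | "s \<noteq> i" "s \<noteq> j" by blast
    then show ?thesis
    proof cases
      case 3
      define p q where "p = (image_unit i j *\<^sub>v v s) $ a" and "q = (image_unit j i *\<^sub>v v s) $ a"
      have act: "(\<phi> (outer (probe d i j z)) *\<^sub>v v s) $ b =
          cnj z * (image_unit i j *\<^sub>v v s) $ b + z * (image_unit j i *\<^sub>v v s) $ b"
        if "z \<in> fourth_roots" "b < r" for z b
        using outer_probe_mult_vec[OF ijs(1,2) root[OF that(1)] v[OF ijs(3)] that(2)]
          off[of i s b] off[of j s b] 3 ijs that by simp
      have form: "(\<phi> (outer (probe d i j (- z))) *\<^sub>v v s) \<bullet>c v s =
          - ((\<phi> (outer (probe d i j z)) *\<^sub>v v s) \<bullet>c v s)" if "z \<in> fourth_roots" for z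
      proof -
        have "- z \<in> fourth_roots" using that by (auto simp: fourth_roots_def)
        then show ?thesis unfolding cinner_eq_sum[OF v[OF ijs(3)]]
          using act that
          by (subst sum_negf[symmetric], intro sum.cong)
            (simp_all add: algebra_simps del: index_mult_mat_vec)
      qed
      have "cnj z * p + z * q = 0" if z: "z \<in> fourth_roots" for z
      proof -
        have "Re ((\<phi> (outer (probe d i j z)) *\<^sub>v v s) \<bullet>c v s) = 0"
          using form[OF z] outer_form_nonneg[OF probe_carrier v[OF ijs(3)], of i j z]
            outer_form_nonneg[OF probe_carrier v[OF ijs(3)], of i j "- z"] by simp
        then have "\<phi> (outer (probe d i j z)) *\<^sub>v v s = 0\<^sub>v r"
          by (rule outer_form_zero_imp_kernel[OF probe_carrier v[OF ijs(3)]])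
        then show ?thesis using act[OF z a] a by (simp add: p_def q_def del: index_mult_mat_vec)
      qed
      from this[of 1] this[of \<i>] have "p + q = 0" "\<i> * (q - p) = 0"
        by (simp_all add: fourth_roots_def algebra_simps)
      then have "p = 0" by simp
      then show ?thesis using 3 a v[OF ijs(1)] by (simp add: p_def del: index_mult_mat_vec)
    next
      \<comment> \<open>The coefficients of \<open>1, z, 1 / z, - z\<^sup>2\<close> in coordinate \<open>a\<close>.\<close>
      define A where "A = v i $ a - (image_unit i j *\<^sub>v v j) $ a"
      define B where "B = (image_unit j i *\<^sub>v v i) $ a - v j $ a"
      define C where "C = (image_unit i j *\<^sub>v v i) $ a"
      define D where "D = (image_unit j i *\<^sub>v v j) $ a"
      have eq: "A + z * B + cnj z * C - z\<^sup>2 * D = 0" if z: "z \<in> fourth_roots" for z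
      proof -
        have y: "v i - z \<cdot>\<^sub>v v j \<in> carrier_vec r" using v ijs by simp
        have "\<phi> (outer (probe d i j z)) *\<^sub>v (v i - z \<cdot>\<^sub>v v j) = 0\<^sub>v r"
          using terms_zero(2)[OF _ _ _ _ z, of i j] ijs ne
          by (intro outer_form_zero_imp_kernel[OF probe_carrier y]) (simp add: probe_term_def)
        then have "(\<phi> (outer (probe d i j z)) *\<^sub>v (v i - z \<cdot>\<^sub>v v j)) $ a = 0"
          using a by (simp del: index_mult_mat_vec)
        then have "v i $ a - z * v j $ a + cnj z * (C - z * (v i $ a - A)) + z * (B + v j $ a - z * D) = 0"
          unfolding outer_probe_mult_vec[OF ijs(1,2) root[OF z] y a]
            image_unit_mult_diff[OF v[OF ijs(1)] v[OF ijs(2)] a]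
          using off[of i j a] off[of j i a] diag[of i a] diag[of j a] ijs ne a
          by (simp add: A_def B_def C_def D_def del: index_mult_mat_vec)
        moreover have "cnj z * (z * (v i $ a - A)) = v i $ a - A" using root[OF z] by (simp flip: mult.assoc add: mult.commute)
        ultimately have "v i $ a - z * v j $ a + (cnj z * C - (v i $ a - A))
            + z * (B + v j $ a - z * D) = 0"
          by (simp only: right_diff_distrib[of "cnj z" C])
        then show ?thesis by (simp add: algebra_simps power2_eq_square)
      qed
      have "A + B + C - D = 0" "A - B - C - D = 0" "A + \<i> * B - \<i> * C + D = 0" "A - \<i> * B + \<i> * C + D = 0"
        using eq[of 1] eq[of "- 1"] eq[of \<i>] eq[of "- \<i>"] by (simp_all add: fourth_roots_def)
      then have "A = 0" "C = 0" by (auto simp: complex_eq_iff)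
      note AC = this
      { case 1 then show ?thesis using AC(1) a v[OF ijs(1)] by (simp add: A_def del: index_mult_mat_vec) }
      { case 2 then show ?thesis using AC(2) a ne v[OF ijs(1)] by (simp add: C_def del: index_mult_mat_vec) }
    qed
  qed
  then show ?thesis
    using image_unit_mult_carrier[OF v[OF ijs(3)]] v[OF ijs(1)]
    by (intro eq_vecI) (auto simp del: index_mult_mat_vec)
qed

text \<open>
  The vectors \<open>v\<^sub>i\<close> all have the same norm, because
  \<open>\<parallel>v\<^sub>i\<parallel>\<^sup>2 = \<langle>\<phi>(E\<^bsub>im\<^esub>) v\<^sub>m, v\<^sub>i\<rangle> = \<langle>v\<^sub>m, \<phi>(E\<^bsub>mi\<^esub>) v\<^sub>i\<rangle> = \<parallel>v\<^sub>m\<parallel>\<^sup>2\<close>. A common rescaling keeps the linear relations.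
\<close>

lemma defect_zero_imp_unit_vectors:
  assumes v: "\<And>k. k < d \<Longrightarrow> v k \<in> carrier_vec r"
    and zero: "of_nat d * (\<Sum>k<d. v k \<bullet>c v k) = (\<Sum>k<d. \<Sum>l<d. cross_term v k l)"
    and nz: "m < d" "v m \<noteq> 0\<^sub>v r"
  shows "\<exists>h. (\<forall>i<d. h i \<in> carrier_vec r \<and> euclid_norm (h i) = 1) \<and>
    (\<forall>i<d. \<forall>j<d. \<forall>s<d. image_unit i j *\<^sub>v h s = (if j = s then 1 else 0) \<cdot>\<^sub>v h i)"
proof -
  note action = defect_zero_imp_matrix_unit_action[OF v zero]
  let ?c = "euclid_norm (v m)"
  have "euclid_norm (v i) = ?c" if "i < d" for i
  proof -
    have "v i \<bullet>c v i = (image_unit i m *\<^sub>v v m) \<bullet>c v i" using action[of i m m] that nz by simp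
    also have "\<dots> = v m \<bullet>c (image_unit m i *\<^sub>v v i)"
      using cinner_adjoint[OF map_carrier[OF matrix_unit_carrier] v v, of m i i m] that nz
      by (simp add: image_unit_adjoint)
    also have "\<dots> = v m \<bullet>c v m" using action[of m i i] that nz by simp
    finally have "(euclid_norm (v i))\<^sup>2 = ?c\<^sup>2"
      unfolding cinner_self[OF v[OF that]] cinner_self[OF v[OF nz(1)]] by (simp only: of_real_eq_iff)
    then show ?thesis by simp
  qed
  moreover have "?c \<noteq> 0" using nz v euclid_norm_eq_0 by blast
  ultimately show ?thesis
    using v action
    by (intro exI[of _ "\<lambda>i. of_real (inverse ?c) \<cdot>\<^sub>v v i"])
      (auto simp: euclid_norm_smult norm_inverse mult_mat_vec[OF map_carrier[OF matrix_unit_carrier] v])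
qed

end


section \<open>Block forms and the isotropic matrices\<close>

text \<open>
  The \<open>k\<close>-th component of a vector of \<open>\<complex>\<^sup>s \<otimes> \<complex>\<^sup>r\<close>, in the indexing that \<open>kron\<close> uses.
\<close>

definition block_vec :: "nat \<Rightarrow> complex vec \<Rightarrow> nat \<Rightarrow> complex vec" where
  "block_vec r w k = vec r (\<lambda>a. w $ (k * r + a))"

lemma block_vec_carrier [simp]: "block_vec r w k \<in> carrier_vec r"
  by (simp add: block_vec_def)

lemma cinner_block_vec:
  assumes w: "w \<in> carrier_vec (s * r)"
  shows "v \<bullet>c w = (\<Sum>k<s. block_vec r v k \<bullet>c block_vec r w k)"
  unfolding cinner_eq_sum[OF w] sum_nat_product
  by (intro sum.cong refl, subst cinner_eq_sum[OF block_vec_carrier]) (simp add: block_vec_def)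

lemma id_tensor_carrier [simp]: "id_tensor s d r \<phi> M \<in> carrier_mat (s * r) (s * r)"
  by (simp add: id_tensor_def)

lemma block_carrier [simp]: "block d M k l \<in> carrier_mat d d"
  by (simp add: block_def)

text \<open>
  In block coordinates the form of \<open>(id \<otimes> \<phi>)(M)\<close> involves \<open>\<phi>\<close> only through its values on the blocks
  of \<open>M\<close>; the tensor encoding enters the positivity arguments through this formula alone.
\<close>

lemma id_tensor_form:
  assumes \<phi>: "\<And>A. A \<in> carrier_mat d d \<Longrightarrow> \<phi> A \<in> carrier_mat r r"
    and w: "w \<in> carrier_vec (s * r)"
  shows "(id_tensor s d r \<phi> M *\<^sub>v w) \<bullet>c w =
    (\<Sum>k<s. \<Sum>l<s. (\<phi> (block d M k l) *\<^sub>v block_vec r w l) \<bullet>c block_vec r w k)"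
proof -
  have entry: "(id_tensor s d r \<phi> M *\<^sub>v w) $ (k * r + a) =
      (\<Sum>l<s. (\<phi> (block d M k l) *\<^sub>v block_vec r w l) $ a)" if "k < s" "a < r" for k a
  proof -
    have "k * r + a < s * r" using that by (rule block_index_less)
    then have "(id_tensor s d r \<phi> M *\<^sub>v w) $ (k * r + a) =
        (\<Sum>l<s. \<Sum>b<r. id_tensor s d r \<phi> M $$ (k * r + a, l * r + b) * w $ (l * r + b))"
      by (simp only: mult_mat_vec_index_sum[OF id_tensor_carrier w] sum_nat_product)
    also have "\<dots> = (\<Sum>l<s. \<Sum>b<r. \<phi> (block d M k l) $$ (a, b) * block_vec r w l $ b)"
      using that by (intro sum.cong refl)
        (simp add: id_tensor_def block_index_less block_vec_def)
    finally show ?thesis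
      using that by (simp only: mult_mat_vec_index_sum[OF \<phi>[OF block_carrier] block_vec_carrier])
  qed
  have "(id_tensor s d r \<phi> M *\<^sub>v w) \<bullet>c w =
      (\<Sum>k<s. \<Sum>a<r. \<Sum>l<s. (\<phi> (block d M k l) *\<^sub>v block_vec r w l) $ a * cnj (block_vec r w k $ a))"
    unfolding cinner_eq_sum[OF w] sum_nat_product
    by (intro sum.cong refl)
      (simp add: entry sum_distrib_right block_vec_def del: index_mult_mat_vec)
  also have "\<dots> = (\<Sum>k<s. \<Sum>l<s. \<Sum>a<r. (\<phi> (block d M k l) *\<^sub>v block_vec r w l) $ a * cnj (block_vec r w k $ a))"
    by (intro sum.cong sum.swap refl)
  finally show ?thesis by (simp only: cinner_eq_sum[OF block_vec_carrier])
qed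

lemma id_tensor_id:
  assumes "M \<in> carrier_mat (s * d) (s * d)"
  shows "id_tensor s d d (\<lambda>A. A) M = M"
  using assms by (intro eq_matI) (auto simp: id_tensor_def block_def mod_less_mult)

lemma block_adjoint:
  assumes "M \<in> hermitian_mats (s * d)" "k < s" "l < s"
  shows "block d M l k = mat_adjoint (block d M k l)"
proof (rule eq_matI)
  fix i j assume "i < dim_row (mat_adjoint (block d M k l))" "j < dim_col (mat_adjoint (block d M k l))"
  then have ij: "i < d" "j < d" by (auto simp: block_def)
  then show "block d M l k $$ (i, j) = mat_adjoint (block d M k l) $$ (i, j)"
    using assms unfolding mat_adjoint_index[OF block_carrier ij]
    by (simp add: hermitian_mats_iff block_def block_index_less)
qed (simp_all add: carrier_matD[OF mat_adjoint_carrier[OF block_carrier]]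
    carrier_matD[OF block_carrier])

lemma id_tensor_hermitian:
  assumes \<phi>: "\<And>A. A \<in> carrier_mat d d \<Longrightarrow> \<phi> A \<in> carrier_mat r r"
    and adj: "\<And>A. A \<in> carrier_mat d d \<Longrightarrow> \<phi> (mat_adjoint A) = mat_adjoint (\<phi> A)"
    and M: "M \<in> hermitian_mats (s * d)"
  shows "id_tensor s d r \<phi> M \<in> hermitian_mats (s * r)"
  unfolding hermitian_mats_iff
proof (intro conjI allI impI)
  fix i j assume ij: "i < s * r" "j < s * r"
  have "\<phi> (block d M (i div r) (j div r)) =
      mat_adjoint (\<phi> (block d M (j div r) (i div r)))"
    using ij by (subst block_adjoint[OF M]) (auto simp: div_less_mult adj)
  then show "cnj (id_tensor s d r \<phi> M $$ (j, i)) = id_tensor s d r \<phi> M $$ (i, j)"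
    using ij by (simp add: id_tensor_def mat_adjoint_index[OF \<phi>[OF block_carrier]] mod_less_mult)
qed simp

lemma tensor_sum_hermitian:
  assumes "\<forall>k<N. X k \<in> hermitian_mats s \<and> Y k \<in> hermitian_mats d"
  shows "tensor_sum s d N X Y \<in> hermitian_mats (s * d)"
  unfolding hermitian_mats_iff
proof (intro conjI allI impI)
  fix i j assume ij: "i < s * d" "j < s * d"
  have "cnj (kron (X k) (Y k) $$ (j, i)) = kron (X k) (Y k) $$ (i, j)" if "k < N" for k
    using assms that ij
    by (auto simp: hermitian_mats_iff kron_def div_less_mult mod_less_mult)
  then show "cnj (tensor_sum s d N X Y $$ (j, i)) = tensor_sum s d N X Y $$ (i, j)"
    using ij by (simp add: tensor_sum_def)
qed (simp add: tensor_sum_def)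

lemma her_tensor_hermitian: "M \<in> her_tensor s d \<Longrightarrow> M \<in> hermitian_mats (s * d)"
  by (auto simp: her_tensor_def tensor_sum_hermitian)

lemma her_tensor_single:
  assumes "X \<in> hermitian_mats s" "Y \<in> hermitian_mats d"
  shows "mat (s * d) (s * d) (\<lambda>ij. kron X Y $$ ij) \<in> her_tensor s d"
proof -
  have "mat (s * d) (s * d) (\<lambda>ij. kron X Y $$ ij) = tensor_sum s d 1 (\<lambda>_. X) (\<lambda>_. Y)"
    by (simp add: tensor_sum_def)
  then show ?thesis using assms unfolding her_tensor_def by blast
qed

lemma her_tensor_add:
  assumes "A \<in> her_tensor s d" "B \<in> her_tensor s d"
  shows "A + B \<in> her_tensor s d"
proof -
  obtain N X Y where A: "A = tensor_sum s d N X Y"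
      "\<forall>k<N. X k \<in> hermitian_mats s \<and> Y k \<in> hermitian_mats d"
    using assms(1) by (auto simp: her_tensor_def)
  obtain N' X' Y' where B: "B = tensor_sum s d N' X' Y'"
      "\<forall>k<N'. X' k \<in> hermitian_mats s \<and> Y' k \<in> hermitian_mats d"
    using assms(2) by (auto simp: her_tensor_def)
  define X2 where "X2 k = (if k < N then X k else X' (k - N))" for k
  define Y2 where "Y2 k = (if k < N then Y k else Y' (k - N))" for k
  have "(\<Sum>k<N. kron (X k) (Y k) $$ ij) + (\<Sum>k<N'. kron (X' k) (Y' k) $$ ij) =
      (\<Sum>k<N + N'. kron (X2 k) (Y2 k) $$ ij)" for ij
  proof -
    have "(\<Sum>k<N + N'. f k) = (\<Sum>k<N. f k) + (\<Sum>k<N'. f (N + k))" for f :: "nat \<Rightarrow> complex"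
      by (induction N') (auto simp: add.assoc)
    then show ?thesis by (simp add: X2_def Y2_def)
  qed
  then have "A + B = tensor_sum s d (N + N') X2 Y2"
    unfolding A(1) B(1) by (intro eq_matI) (auto simp: tensor_sum_def)
  moreover have "\<forall>k<N + N'. X2 k \<in> hermitian_mats s \<and> Y2 k \<in> hermitian_mats d"
    using A(2) B(2) by (auto simp: X2_def Y2_def)
  ultimately show ?thesis unfolding her_tensor_def by blast
qed

lemma her_tensor_sum:
  fixes F :: "'i \<Rightarrow> complex mat"
  assumes "finite S" "\<And>a. a \<in> S \<Longrightarrow> F a \<in> her_tensor s d"
  shows "mat (s * d) (s * d) (\<lambda>ij. \<Sum>a\<in>S. F a $$ ij) \<in> her_tensor s d"
  using assms
proof (induction S rule: finite_induct)
  case empty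
  have "mat (s * d) (s * d) (\<lambda>ij. 0) = tensor_sum s d 0 (\<lambda>_. 0\<^sub>m s s) (\<lambda>_. 0\<^sub>m d d)"
    by (simp add: tensor_sum_def)
  then show ?case unfolding her_tensor_def by auto
next
  case (insert a S)
  have "F a \<in> carrier_mat (s * d) (s * d)"
    using her_tensor_hermitian[of "F a" s d] insert.prems by (auto simp: hermitian_mats_iff)
  then have "mat (s * d) (s * d) (\<lambda>ij. \<Sum>a\<in>insert a S. F a $$ ij) =
      F a + mat (s * d) (s * d) (\<lambda>ij. \<Sum>a\<in>S. F a $$ ij)"
    using insert.hyps by (intro eq_matI) auto
  then show ?case using insert by (simp add: her_tensor_add)
qed

text \<open>
  The matrix \<open>t I - \<Omega>\<close> with \<open>\<Omega> = \<Sum>k l. E\<^bsub>kl\<^esub> \<otimes> E\<^bsub>kl\<^esub>\<close>: the index \<open>p = k d + a\<close> stands for \<open>e\<^sub>k \<otimes> e\<^sub>a\<close>, and \<open>\<Omega>\<close>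
  is the rank one matrix of the vector \<open>\<Sum>k. e\<^sub>k \<otimes> e\<^sub>k\<close>.
\<close>

definition isotropic :: "nat \<Rightarrow> real \<Rightarrow> complex mat" where
  "isotropic d t = mat (d * d) (d * d)
    (\<lambda>(p, q). (if p = q then of_real t else 0) -
      (if p div d = p mod d \<and> q div d = q mod d then 1 else 0))"

lemma block_isotropic:
  assumes "k < d" "l < d"
  shows "block d (isotropic d t) k l =
    (if k = l then of_real t else 0) \<cdot>\<^sub>m 1\<^sub>m d + (- 1) \<cdot>\<^sub>m matrix_unit d k l"
proof (rule eq_matI)
  fix i j assume "i < dim_row ((if k = l then of_real t else 0) \<cdot>\<^sub>m 1\<^sub>m d + (- 1) \<cdot>\<^sub>m matrix_unit d k l)"
    "j < dim_col ((if k = l then of_real t else 0) \<cdot>\<^sub>m 1\<^sub>m d + (- 1) \<cdot>\<^sub>m matrix_unit d k l)"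
  then have ij: "i < d" "j < d" by (auto simp: matrix_unit_def)
  have "k * d + i = l * d + j \<longleftrightarrow> k = l \<and> i = j"
  proof
    assume eq: "k * d + i = l * d + j"
    have "(k * d + i) div d = k" "(l * d + j) div d = l" using ij by auto
    then show "k = l \<and> i = j" using eq by auto
  qed auto
  then show "block d (isotropic d t) k l $$ (i, j) =
      ((if k = l then of_real t else 0) \<cdot>\<^sub>m 1\<^sub>m d + (- 1) \<cdot>\<^sub>m matrix_unit d k l) $$ (i, j)"
    using ij assms by (auto simp: block_def isotropic_def matrix_unit_def block_index_less)
qed (auto simp: block_def matrix_unit_def)

lemma hermitian_smult:
  "A \<in> hermitian_mats n \<Longrightarrow> of_real c \<cdot>\<^sub>m A \<in> hermitian_mats n"
  by (auto simp: hermitian_mats_iff)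

lemma one_mat_hermitian: "1\<^sub>m n \<in> hermitian_mats n"
  by (auto simp: hermitian_mats_iff)

text \<open>
  The matrix units are not Hermitian, so \<open>\<Omega>\<close> has to be rewritten with Hermitian factors: for
  \<open>X = E\<^bsub>kl\<^esub> + E\<^bsub>lk\<^esub>\<close> and \<open>Y = \<i> (E\<^bsub>kl\<^esub> - E\<^bsub>lk\<^esub>)\<close>, one has \<open>X \<otimes> X - Y \<otimes> Y = 2 (E\<^bsub>kl\<^esub> \<otimes> E\<^bsub>kl\<^esub> + E\<^bsub>lk\<^esub> \<otimes> E\<^bsub>lk\<^esub>)\<close>. Summed
  over all pairs \<open>k, l\<close> this is \<open>4 \<Omega>\<close>.
\<close>

lemma isotropic_in_her_tensor: "isotropic d t \<in> her_tensor d d"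
proof -
  let ?E = "matrix_unit d"
  define \<delta> :: "nat \<Rightarrow> nat \<Rightarrow> complex" where "\<delta> p q = (if p = q then 1 else 0)" for p q
  have cnj_\<delta>: "cnj (\<delta> p q) = \<delta> p q" for p q by (simp add: \<delta>_def)
  have sum_\<delta>: "(\<Sum>k<d. \<delta> p k * f k) = f p" if "p < d" for p f
  proof -
    have "(\<Sum>k<d. \<delta> p k * f k) = (\<Sum>k<d. if k = p then f k else 0)"
      by (intro sum.cong) (auto simp: \<delta>_def)
    then show ?thesis using that by simp
  qed
  define X where "X k l = ?E k l + ?E l k" for k l
  define Y where "Y k l = \<i> \<cdot>\<^sub>m (?E k l + (- 1) \<cdot>\<^sub>m ?E l k)" for k l
  have E: "?E k l $$ (a, b) = \<delta> a k * \<delta> b l" if "a < d" "b < d" for k l a b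
    using that by (simp add: matrix_unit_def \<delta>_def)
  have X: "X k l $$ (a, b) = \<delta> a k * \<delta> b l + \<delta> a l * \<delta> b k"
    and Y: "Y k l $$ (a, b) = \<i> * (\<delta> a k * \<delta> b l - \<delta> a l * \<delta> b k)"
    if "a < d" "b < d" for k l a b
    using that by (simp_all add: X_def Y_def E carrier_matD[OF matrix_unit_carrier])
  have Xc: "X k l \<in> carrier_mat d d" and Yc: "Y k l \<in> carrier_mat d d" for k l
    by (simp_all add: X_def Y_def)
  have XH: "X k l \<in> hermitian_mats d" and YH: "Y k l \<in> hermitian_mats d" for k l
    by (simp_all add: hermitian_mats_iff Xc Yc X Y cnj_\<delta> algebra_simps)
  let ?M = "\<lambda>A B. mat (d * d) (d * d) (\<lambda>ij. kron A B $$ ij)"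
  define T where "T k l = ?M (of_real (- 1 / 4) \<cdot>\<^sub>m X k l) (X k l)
    + ?M (of_real (1 / 4) \<cdot>\<^sub>m Y k l) (Y k l)" for k l
  define S where "S k = mat (d * d) (d * d) (\<lambda>ij. \<Sum>l<d. T k l $$ ij)" for k
  let ?R = "mat (d * d) (d * d) (\<lambda>ij. \<Sum>k<d. S k $$ ij)"
  have "T k l \<in> her_tensor d d" for k l
    unfolding T_def by (intro her_tensor_add her_tensor_single hermitian_smult XH YH)
  then have "S k \<in> her_tensor d d" for k unfolding S_def by (intro her_tensor_sum) auto
  then have "?R + ?M (of_real t \<cdot>\<^sub>m 1\<^sub>m d) (1\<^sub>m d) \<in> her_tensor d d"
    by (intro her_tensor_add her_tensor_single hermitian_smult one_mat_hermitian her_tensor_sum) auto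
  moreover have "?R + ?M (of_real t \<cdot>\<^sub>m 1\<^sub>m d) (1\<^sub>m d) = isotropic d t"
  proof (rule eq_matI)
    fix p q assume "p < dim_row (isotropic d t)" "q < dim_col (isotropic d t)"
    then have pq: "p < d * d" "q < d * d" by (auto simp: isotropic_def)
    define a b i j where abij: "a = p div d" "b = q div d" "i = p mod d" "j = q mod d"
    have lt: "a < d" "b < d" "i < d" "j < d" using pq by (auto simp: abij div_less_mult mod_less_mult)
    have "T k l $$ (p, q) = - (1 / 2) * (\<delta> a k * (\<delta> b l * (\<delta> i k * \<delta> j l))
        + \<delta> b k * (\<delta> a l * (\<delta> j k * \<delta> i l)))" for k l
      using pq lt
      by (simp add: T_def kron_def abij[symmetric] carrier_matD[OF Xc] carrier_matD[OF Yc] X Y)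
        (simp add: field_simps)
    then have "(\<Sum>k<d. \<Sum>l<d. T k l $$ (p, q)) =
        - (1 / 2) * ((\<Sum>k<d. \<delta> a k * (\<Sum>l<d. \<delta> b l * (\<delta> i k * \<delta> j l)))
          + (\<Sum>k<d. \<delta> b k * (\<Sum>l<d. \<delta> a l * (\<delta> j k * \<delta> i l))))"
      by (simp only: sum_distrib_left sum.distrib distrib_left)
    also have "\<dots> = - (\<delta> i a * \<delta> j b)"
      by (simp only: sum_\<delta>[OF lt(1)] sum_\<delta>[OF lt(2)]) simp
    finally have sum_T: "(\<Sum>k<d. \<Sum>l<d. T k l $$ (p, q)) = - (\<delta> i a * \<delta> j b)" .
    have "(?R + ?M (of_real t \<cdot>\<^sub>m 1\<^sub>m d) (1\<^sub>m d)) $$ (p, q) =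
        - (\<delta> i a * \<delta> j b) + of_real t * (\<delta> a b * \<delta> i j)"
      using pq lt sum_T by (simp add: S_def kron_def abij[symmetric] \<delta>_def)
    also have "\<dots> = isotropic d t $$ (p, q)"
    proof -
      have "p = a * d + i" "q = b * d + j" by (auto simp: abij)
      then have "p = q \<longleftrightarrow> a = b \<and> i = j" using abij by metis
      then show ?thesis using pq by (simp add: isotropic_def abij[symmetric] \<delta>_def)
    qed
    finally show "(?R + ?M (of_real t \<cdot>\<^sub>m 1\<^sub>m d) (1\<^sub>m d)) $$ (p, q) = isotropic d t $$ (p, q)" .
  qed (auto simp: isotropic_def)
  ultimately show ?thesis by simp
qed


section \<open>From containment to unit vectors\<close>

text \<open>
  The form of \<open>t I - \<Omega>\<close> at \<open>w = \<Sum>k. e\<^sub>k \<otimes> e\<^sub>k\<close> is \<open>t d - d\<^sup>2\<close>.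
\<close>

lemma psd_isotropic_imp:
  assumes "psd (isotropic d t)" "0 < d"
  shows "real d \<le> t"
proof -
  define w where "w = vec (d * d) (\<lambda>p. if p div d = p mod d then 1 else 0 :: complex)"
  have w: "w \<in> carrier_vec (d * d)" by (simp add: w_def)
  have I: "isotropic d t \<in> carrier_mat (d * d) (d * d)" by (simp add: isotropic_def)
  have blk: "block_vec d w k = unit_vec d k" if "k < d" for k
    using that by (intro eq_vecI) (auto simp: block_vec_def w_def block_index_less unit_vec_def)
  have unit_form: "(block d (isotropic d t) k l *\<^sub>v unit_vec d l) \<bullet>c unit_vec d k =
      (if k = l then of_real t else 0) - 1" if "k < d" "l < d" for k l
  proof -
    have "(block d (isotropic d t) k l *\<^sub>v unit_vec d l) \<bullet>c unit_vec d k =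
        (\<Sum>a<d. (block d (isotropic d t) k l *\<^sub>v unit_vec d l) $ a * (if a = k then 1 else 0))"
      by (simp add: cinner_eq_sum[of _ d] unit_vec_def if_distrib del: index_mult_mat_vec cong: if_cong)
    also have "\<dots> = (block d (isotropic d t) k l *\<^sub>v unit_vec d l) $ k"
      using that by (simp add: if_distrib del: index_mult_mat_vec cong: if_cong)
    also have "\<dots> = block d (isotropic d t) k l $$ (k, l)"
      using that by (simp add: mult_mat_vec_index_sum[OF block_carrier] unit_vec_def
          if_distrib del: index_mult_mat_vec cong: if_cong)
    also have "\<dots> = (if k = l then of_real t else 0) - 1"
      using that by (simp add: block_isotropic matrix_unit_def)
    finally show ?thesis .
  qed
  have "(isotropic d t *\<^sub>v w) \<bullet>c w = (\<Sum>k<d. \<Sum>l<d. (if k = l then of_real t else 0) - 1)"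
    using id_tensor_form[of d "\<lambda>A. A" d w d "isotropic d t"] w
    by (simp add: id_tensor_id[OF I] blk unit_form)
  also have "\<dots> = of_real (real d * t - real d * real d)"
    by (simp add: sum_subtractf algebra_simps)
  finally have "0 \<le> real d * t - real d * real d"
    using assms(1) w psd_iff_Re[OF I] by (metis Re_complex_of_real)
  then show ?thesis using assms(2) by (simp add: mult_le_cancel_left_pos)
qed

context unital_positive_map
begin

text \<open>
  This identifies the form of \<open>(id \<otimes> \<phi>)(d I - \<Omega>)\<close> with the defect of the trace inequality.
\<close>

lemma id_tensor_isotropic_form:
  assumes w: "w \<in> carrier_vec (d * r)"
  shows "(id_tensor d d r \<phi> (isotropic d t) *\<^sub>v w) \<bullet>c w =
    of_real t * (\<Sum>k<d. block_vec r w k \<bullet>c block_vec r w k)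
    - (\<Sum>k<d. \<Sum>l<d. cross_term (block_vec r w) k l)"
proof -
  have "\<phi> (block d (isotropic d t) k l) *\<^sub>v block_vec r w l =
      (if k = l then of_real t else 0) \<cdot>\<^sub>v block_vec r w l - image_unit k l *\<^sub>v block_vec r w l"
    if "k < d" "l < d" for k l
  proof -
    let ?c = "if k = l then complex_of_real t else 0"
    have "\<phi> (block d (isotropic d t) k l) = ?c \<cdot>\<^sub>m 1\<^sub>m r + (- 1) \<cdot>\<^sub>m image_unit k l"
      unfolding block_isotropic[OF that] using add smult unital
      by (metis matrix_unit_carrier one_carrier_mat smult_carrier_mat)
    also have "\<dots> = ?c \<cdot>\<^sub>m 1\<^sub>m r - image_unit k l"
      by (rule mat_diff_eq_add_smult[symmetric, where m = r and n = r]) auto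
    finally show ?thesis
      by (simp only: minus_mult_distrib_mat_vec[OF smult_carrier_mat[OF one_carrier_mat]
            map_carrier[OF matrix_unit_carrier] block_vec_carrier])
        (simp add: smult_mat_mult_vec carrier_vecD[OF block_vec_carrier])
  qed
  then have "(id_tensor d d r \<phi> (isotropic d t) *\<^sub>v w) \<bullet>c w =
    (\<Sum>k<d. \<Sum>l<d. ((if k = l then of_real t else 0) \<cdot>\<^sub>v block_vec r w l
      - image_unit k l *\<^sub>v block_vec r w l) \<bullet>c block_vec r w k)"
    by (simp add: id_tensor_form[OF map_carrier w])
  also have "\<dots> = (\<Sum>k<d. \<Sum>l<d. (if l = k then of_real t * (block_vec r w l \<bullet>c block_vec r w k) else 0)
      - cross_term (block_vec r w) k l)"
  proof (intro sum.cong refl)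
    fix k l
    show "((if k = l then of_real t else 0) \<cdot>\<^sub>v block_vec r w l
        - image_unit k l *\<^sub>v block_vec r w l) \<bullet>c block_vec r w k =
      (if l = k then of_real t * (block_vec r w l \<bullet>c block_vec r w k) else 0)
      - cross_term (block_vec r w) k l"
      unfolding cross_term_def
      by (subst minus_scalar_prod_distrib[where n = r])
        (auto simp: carrier_vecD[OF block_vec_carrier])
  qed
  finally show ?thesis by (simp add: sum_subtractf sum_distrib_left)
qed

lemma id_tensor_isotropic_hermitian: "id_tensor d d r \<phi> (isotropic d t) \<in> hermitian_mats (d * r)"
  by (rule id_tensor_hermitian)
    (auto intro: adjoint her_tensor_hermitian isotropic_in_her_tensor)

text \<open>
  If \<open>(id \<otimes> \<phi>)(d I - \<Omega>)\<close> had trivial kernel, it could be lowered by a multiple \<open>e\<close> of the identity and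
  stay positive semidefinite; containment would then make \<open>(d - e) I - \<Omega>\<close> positive semidefinite as
  well. A nonzero kernel vector has zero defect.
\<close>

lemma spectrahedron_in_Psd_imp_unit_vectors:
  assumes sub: "\<And>s. 1 \<le> s \<Longrightarrow> free_spectrahedron d r \<phi> s \<subseteq> Psd d s"
  shows "\<exists>h. (\<forall>i<d. h i \<in> carrier_vec r \<and> euclid_norm (h i) = 1) \<and>
    (\<forall>i<d. \<forall>j<d. \<forall>s<d. image_unit i j *\<^sub>v h s = (if j = s then 1 else 0) \<cdot>\<^sub>v h i)"
proof (cases "d = 0")
  case False
  let ?M = "\<lambda>t. id_tensor d d r \<phi> (isotropic d t)"
  have form: "Re ((?M t *\<^sub>v w) \<bullet>c w) = Re ((?M (real d) *\<^sub>v w) \<bullet>c w) - (real d - t) * (euclid_norm w)\<^sup>2"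
    if w: "w \<in> carrier_vec (d * r)" for t w
  proof -
    have "(\<Sum>k<d. block_vec r w k \<bullet>c block_vec r w k) = of_real ((euclid_norm w)\<^sup>2)"
      using cinner_block_vec[OF w, of w] cinner_self[OF w] by simp
    then show ?thesis unfolding id_tensor_isotropic_form[OF w]
      by (simp add: algebra_simps del: of_real_power)
  qed
  have "\<exists>w\<in>carrier_vec (d * r). ?M (real d) *\<^sub>v w = 0\<^sub>v (d * r) \<and> w \<noteq> 0\<^sub>v (d * r)"
  proof (rule ccontr)
    assume no_kernel: "\<not> ?thesis"
    obtain e where "e > 0" and e: "\<And>w. w \<in> carrier_vec (d * r) \<Longrightarrow>
        e * (euclid_norm w)\<^sup>2 \<le> Re ((?M (real d) *\<^sub>v w) \<bullet>c w)"
    proof -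
      have "0 \<le> Re ((?M (real d) *\<^sub>v w) \<bullet>c w)" if "w \<in> carrier_vec (d * r)" for w
        unfolding id_tensor_isotropic_form[OF that]
        using Re_defect_nonneg[of "block_vec r w"] by simp
      then have "\<exists>e>0. \<forall>w\<in>carrier_vec (d * r).
          e * (euclid_norm w)\<^sup>2 \<le> Re ((?M (real d) *\<^sub>v w) \<bullet>c w)"
        using no_kernel by (intro coercive_of_trivial_kernel id_tensor_isotropic_hermitian) auto
      then show ?thesis using that by blast
    qed
    have "psd (?M (real d - e))"
      unfolding psd_iff_Re[OF id_tensor_carrier]
      using e by (auto simp: form[of _ "real d - e"] id_tensor_isotropic_hermitian)
    then have "isotropic d (real d - e) \<in> free_spectrahedron d r \<phi> d"
      by (simp add: free_spectrahedron_def isotropic_in_her_tensor)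
    then have "psd (isotropic d (real d - e))" using sub[of d] False by (auto simp: Psd_def)
    then show False using psd_isotropic_imp[of d "real d - e"] False \<open>e > 0\<close> by simp
  qed
  then obtain w where w: "w \<in> carrier_vec (d * r)" "?M (real d) *\<^sub>v w = 0\<^sub>v (d * r)" "w \<noteq> 0\<^sub>v (d * r)"
    by blast
  obtain p where p: "p < d * r" "w $ p \<noteq> 0"
  proof (rule ccontr)
    assume "\<not> thesis"
    then have "w = 0\<^sub>v (d * r)" using w(1) that by (intro eq_vecI) auto
    then show False using w(3) by simp
  qed
  have "block_vec r w (p div r) $ (p mod r) = w $ p"
    using mod_less_mult[OF p(1)] by (simp add: block_vec_def)
  then have "block_vec r w (p div r) \<noteq> 0\<^sub>v r" using p mod_less_mult[OF p(1)] by auto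
  moreover have "of_nat d * (\<Sum>k<d. block_vec r w k \<bullet>c block_vec r w k) =
      (\<Sum>k<d. \<Sum>l<d. cross_term (block_vec r w) k l)"
    using id_tensor_isotropic_form[OF w(1), of "real d"] w(1,2) by simp
  ultimately show ?thesis
    using defect_zero_imp_unit_vectors[of "block_vec r w" "p div r"] div_less_mult[OF p(1)] by simp
qed simp

end


section \<open>Orthonormal systems and block diagonal form\<close>

definition orthonormal :: "nat \<Rightarrow> nat \<Rightarrow> (nat \<Rightarrow> complex vec) \<Rightarrow> bool" where
  "orthonormal r n h \<longleftrightarrow> (\<forall>i<n. h i \<in> carrier_vec r) \<and>
    (\<forall>i<n. \<forall>j<n. h i \<bullet>c h j = (if i = j then 1 else 0))"

text \<open>
  Fewer than \<open>r\<close> linear conditions on \<open>\<complex>\<^sup>r\<close> have a nonzero solution: padded with zero rows, they form a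
  square matrix of determinant zero.
\<close>

lemma orthonormal_extend:
  assumes h: "orthonormal r n h" and n: "n < r"
  shows "\<exists>u. orthonormal r (Suc n) (h(n := u))"
proof -
  define A where "A = mat r r (\<lambda>(i, j). if i < n then cnj (h i $ j) else 0)"
  have A: "A \<in> carrier_mat r r" by (simp add: A_def)
  have "A = mat\<^sub>r r r (\<lambda>i. if i = n then 0\<^sub>v r else row A i)"
    by (intro eq_matI) (auto simp: A_def)
  also have "det \<dots> = 0" using n A by (intro det_row_0) auto
  finally have "det A = 0" .
  then obtain v where v: "v \<in> carrier_vec r" "v \<noteq> 0\<^sub>v r" "A *\<^sub>v v = 0\<^sub>v r"
    using det_0_iff_vec_prod_zero_field[OF A] by blast
  have orth: "v \<bullet>c h i = 0" if i: "i < n" for i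
  proof -
    have "h i \<in> carrier_vec r" using h i by (simp add: orthonormal_def)
    then have "v \<bullet>c h i = (\<Sum>j<r. A $$ (i, j) * v $ j)"
      using i n by (simp add: cinner_eq_sum A_def mult.commute)
    also have "\<dots> = (A *\<^sub>v v) $ i"
      using i n by (subst mult_mat_vec_index_sum[OF A v(1)]) auto
    also have "\<dots> = 0" using v(3) i n by simp
    finally show ?thesis .
  qed
  define u where "u = complex_of_real (inverse (euclid_norm v)) \<cdot>\<^sub>v v"
  have u: "u \<in> carrier_vec r" using v(1) by (simp add: u_def)
  have "euclid_norm v \<noteq> 0" using v by (simp add: euclid_norm_eq_0)
  then have "euclid_norm u = 1" by (simp add: u_def euclid_norm_smult norm_inverse)
  then have uu: "u \<bullet>c u = 1" by (simp add: cinner_self[OF u])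
  have uh: "u \<bullet>c h i = 0" "h i \<bullet>c u = 0" if i: "i < n" for i
  proof -
    have hi: "h i \<in> carrier_vec r" using h i by (simp add: orthonormal_def)
    show "u \<bullet>c h i = 0" using orth[OF i] v(1) hi by (simp add: u_def)
    then show "h i \<bullet>c u = 0" using cinner_commute[OF u hi] by simp
  qed
  show ?thesis
    using h u uu uh by (intro exI[of _ u]) (auto simp: orthonormal_def less_Suc_eq)
qed

lemma orthonormal_complete:
  assumes "orthonormal r n h" "n \<le> r"
  shows "\<exists>g. orthonormal r r g \<and> (\<forall>i<n. g i = h i)"
  using assms(2,1)
proof (induction arbitrary: h rule: inc_induct)
  case base
  then show ?case by blast
next
  case (step n)
  obtain u where "orthonormal r (Suc n) (h(n := u))"
    using orthonormal_extend[OF step.prems step.hyps(2)] by blast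
  then obtain g where "orthonormal r r g" "\<forall>i<Suc n. g i = (h(n := u)) i"
    using step.IH by blast
  then show ?case by (intro exI[of _ g]) auto
qed

definition cols_mat :: "nat \<Rightarrow> nat \<Rightarrow> (nat \<Rightarrow> complex vec) \<Rightarrow> complex mat" where
  "cols_mat r n g = mat r n (\<lambda>(a, i). g i $ a)"

lemma cols_mat_carrier [simp]: "cols_mat r n g \<in> carrier_mat r n"
  by (simp add: cols_mat_def)

lemma dim_cols_mat [simp]: "dim_row (cols_mat r n g) = r" "dim_col (cols_mat r n g) = n"
  by (simp_all add: cols_mat_def)

lemma col_cols_mat [simp]: "i < n \<Longrightarrow> g i \<in> carrier_vec r \<Longrightarrow> col (cols_mat r n g) i = g i"
  by (intro eq_vecI) (auto simp: cols_mat_def)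

lemma adjoint_mult_vec_index:
  fixes V :: "complex mat"
  assumes V: "V \<in> carrier_mat r n" and w: "w \<in> carrier_vec r" and i: "i < n"
  shows "(mat_adjoint V *\<^sub>v w) $ i = w \<bullet>c col V i"
  using V i
  by (subst mult_mat_vec_index_sum[OF mat_adjoint_carrier[OF V] w i])
    (simp add: cinner_eq_sum[of _ r] mat_adjoint_index[OF V] mult.commute)

lemma compression_index:
  fixes V :: "complex mat"
  assumes V: "V \<in> carrier_mat r n" and B: "B \<in> carrier_mat r r" and ij: "i < n" "j < n"
  shows "(mat_adjoint V * B * V) $$ (i, j) = (B *\<^sub>v col V j) \<bullet>c col V i"
proof -
  have "mat_adjoint V * B * V = mat_adjoint V * (B * V)"
    using V B by (intro assoc_mult_mat[of _ n r _ r _ n]) auto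
  then have "(mat_adjoint V * B * V) $$ (i, j) = col (mat_adjoint V * (B * V)) j $ i"
    using V ij by auto
  also have "col (mat_adjoint V * (B * V)) j = mat_adjoint V *\<^sub>v (B *\<^sub>v col V j)"
    using V B ij col_mult2[OF mat_adjoint_carrier[OF V] mult_carrier_mat[OF B V] ij(2)]
      col_mult2[OF B V ij(2)] by simp
  also have "\<dots> $ i = (B *\<^sub>v col V j) \<bullet>c col V i"
    using V B ij by (intro adjoint_mult_vec_index) (auto intro: mult_mat_vec_carrier)
  finally show ?thesis .
qed

lemma unitary_cols_mat:
  assumes g: "orthonormal r r g"
  shows "unitary_mat r (cols_mat r r g)"
proof -
  let ?U = "cols_mat r r g"
  have gc: "g i \<in> carrier_vec r" if "i < r" for i using g that by (simp add: orthonormal_def)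
  have "mat_adjoint ?U * ?U = mat_adjoint ?U * 1\<^sub>m r * ?U" 
    using right_mult_one_mat[OF mat_adjoint_carrier[OF cols_mat_carrier]] by simp
  also have "\<dots> = 1\<^sub>m r"
  proof (rule eq_matI)
    fix i j assume "i < dim_row (1\<^sub>m r)" "j < dim_col (1\<^sub>m r)"
    then have ij: "i < r" "j < r" by auto
    then show "(mat_adjoint ?U * 1\<^sub>m r * ?U) $$ (i, j) = 1\<^sub>m r $$ (i, j)"
      using g gc
      by (subst compression_index[OF cols_mat_carrier one_carrier_mat]) (auto simp: orthonormal_def)
  qed simp_all
  finally have "mat_adjoint ?U * ?U = 1\<^sub>m r" .
  moreover from this have "?U * mat_adjoint ?U = 1\<^sub>m r"
    by (rule mat_mult_left_right_inverse[rotated 2]) simp_all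
  ultimately show ?thesis by (simp add: unitary_mat_def)
qed

text \<open>
  The first \<open>r\<close> of more than \<open>r\<close> orthonormal vectors would already form a unitary matrix, and the next
  vector would be orthogonal to all its columns.
\<close>

lemma orthonormal_length_le:
  assumes h: "orthonormal r n h"
  shows "n \<le> r"
proof (rule ccontr)
  assume "\<not> n \<le> r"
  then have rn: "r < n" by simp
  have hc: "h i \<in> carrier_vec r" if "i < n" for i using h that by (simp add: orthonormal_def)
  have "orthonormal r r h" using h rn by (simp add: orthonormal_def)
  then have U: "cols_mat r r h * mat_adjoint (cols_mat r r h) = 1\<^sub>m r"
    using unitary_cols_mat by (auto simp: unitary_mat_def)
  have "mat_adjoint (cols_mat r r h) *\<^sub>v h r = 0\<^sub>v r"
  proof (rule eq_vecI)
    fix i assume "i < dim_vec (0\<^sub>v r :: complex vec)"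
    then have i: "i < r" by simp
    have "(mat_adjoint (cols_mat r r h) *\<^sub>v h r) $ i = h r \<bullet>c h i"
      using i rn hc by (subst adjoint_mult_vec_index[OF cols_mat_carrier]) auto
    then show "(mat_adjoint (cols_mat r r h) *\<^sub>v h r) $ i = 0\<^sub>v r $ i"
      using h i rn by (simp add: orthonormal_def)
  qed simp
  then have "cols_mat r r h *\<^sub>v (mat_adjoint (cols_mat r r h) *\<^sub>v h r) = 0\<^sub>v r"
    by (intro eq_vecI) (auto simp: cols_mat_def)
  then have "h r = 0\<^sub>v r"
    using assoc_mult_mat_vec[OF cols_mat_carrier[of r r h] mat_adjoint_carrier[OF cols_mat_carrier[of r r h]]
        hc[OF rn]]
      U hc[OF rn] by simp
  then have "h r \<bullet>c h r = 0" by simp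
  then show False using h rn by (simp add: orthonormal_def)
qed

context unital_positive_map
begin

text \<open>
  The relations make the \<open>h\<^sub>i\<close> orthonormal, since \<open>\<phi>(E\<^bsub>ii\<^esub>)\<close> is self-adjoint, fixes \<open>h\<^sub>i\<close> and kills the
  others. They also give \<open>\<phi>(A) h\<^sub>j = \<Sum>k. A\<^bsub>kj\<^esub> h\<^sub>k\<close>, so the span of the \<open>h\<^sub>i\<close> is invariant under all \<open>\<phi>(A)\<close>;
  as \<open>\<phi>(A)* = \<phi>(A*)\<close>, its orthogonal complement is invariant too. In an orthonormal basis that extends
  the \<open>h\<^sub>i\<close>, both off-diagonal blocks vanish.
\<close>

lemma unit_vectors_imp_block_diagonal:
  assumes h: "\<And>i. i < d \<Longrightarrow> h i \<in> carrier_vec r \<and> euclid_norm (h i) = 1"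
    and action: "\<And>i j s. i < d \<Longrightarrow> j < d \<Longrightarrow> s < d \<Longrightarrow>
      image_unit i j *\<^sub>v h s = (if j = s then 1 else 0) \<cdot>\<^sub>v h i"
  shows "\<exists>U \<psi>. unitary_mat r U \<and> \<psi> \<in> carrier_mat d d \<rightarrow> carrier_mat (r - d) (r - d) \<and>
    (\<forall>A\<in>carrier_mat d d. mat_adjoint U * \<phi> A * U =
      four_block_mat A (0\<^sub>m d (r - d)) (0\<^sub>m (r - d) d) (\<psi> A))"
proof -
  have hc: "h i \<in> carrier_vec r" if "i < d" for i using h that by blast
  have "h i \<bullet>c h j = (if i = j then 1 else 0)" if ij: "i < d" "j < d" for i j
  proof (cases "i = j")
    case True
    then show ?thesis using h[OF ij(1)] cinner_self[OF hc[OF ij(1)]] by simp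
  next
    case False
    have "h i \<bullet>c h j = (image_unit i i *\<^sub>v h i) \<bullet>c h j" using action ij by simp
    also have "\<dots> = h i \<bullet>c (image_unit i i *\<^sub>v h j)"
      using cinner_adjoint[OF map_carrier[OF matrix_unit_carrier] hc hc, of i j i i] ij
      by (simp add: image_unit_adjoint)
    also have "\<dots> = 0" using action[of i i j] False ij hc
      by (simp add: cinner_eq_sum[of _ r] carrier_vecD[OF hc])
    finally show ?thesis using False by simp
  qed
  then have on: "orthonormal r d h" using hc by (simp add: orthonormal_def)
  have dr: "d \<le> r" by (rule orthonormal_length_le[OF on])
  obtain g where g: "orthonormal r r g" and gh: "\<And>i. i < d \<Longrightarrow> g i = h i"
    using orthonormal_complete[OF on dr] by blast
  have gc: "g i \<in> carrier_vec r" if "i < r" for i using g that by (simp add: orthonormal_def)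
  have gg: "g i \<bullet>c g j = (if i = j then 1 else 0)" if "i < r" "j < r" for i j
    using g that by (simp add: orthonormal_def)
  let ?U = "cols_mat r r g"
  define \<psi> where "\<psi> A = mat (r - d) (r - d) (\<lambda>(i, j). (mat_adjoint ?U * \<phi> A * ?U) $$ (i + d, j + d))" for A
  have h_smult: "(c \<cdot>\<^sub>v h k) $ a = c * h k $ a" if "k < d" "a < r" for c k a
    using hc[OF that(1)] that(2) by simp
  have left: "(\<phi> A *\<^sub>v g j) \<bullet>c g i = (if i < d then A $$ (i, j) else 0)"
    if A: "A \<in> carrier_mat d d" and ij: "i < r" "j < d" for A i j
  proof -
    have "(\<phi> A *\<^sub>v g j) $ a = (\<Sum>k<d. A $$ (k, j) * g k $ a)" if a: "a < r" for a
    proof -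
      have "(\<phi> A *\<^sub>v g j) $ a = (\<Sum>k<d. \<Sum>l<d. if l = j then A $$ (k, l) * g k $ a else 0)"
        unfolding gh[OF ij(2)] map_mult_vec_expand[OF A hc[OF ij(2)] a]
        using ij a by (intro sum.cong refl) (auto simp: action gh h_smult simp del: index_mult_mat_vec)
      then show ?thesis using ij by simp
    qed
    then have "(\<phi> A *\<^sub>v g j) \<bullet>c g i = (\<Sum>a<r. \<Sum>k<d. A $$ (k, j) * g k $ a * cnj (g i $ a))"
      by (simp add: cinner_eq_sum[OF gc[OF ij(1)]] sum_distrib_right del: index_mult_mat_vec)
    also have "\<dots> = (\<Sum>k<d. A $$ (k, j) * (g k \<bullet>c g i))"
      unfolding cinner_eq_sum[OF gc[OF ij(1)]] sum_distrib_left
      by (subst sum.swap) (simp add: mult.assoc)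
    also have "\<dots> = (\<Sum>k<d. if k = i then A $$ (k, j) else 0)"
      using ij dr by (intro sum.cong) (auto simp: gg)
    finally show ?thesis by simp
  qed
  have right: "(\<phi> A *\<^sub>v g j) \<bullet>c g i = 0"
    if A: "A \<in> carrier_mat d d" and ij: "i < d" "d \<le> j" "j < r" for A i j
  proof -
    have ir: "i < r" using ij by simp
    have Ac: "mat_adjoint A \<in> carrier_mat d d" using A by simp
    have "(\<phi> A *\<^sub>v g j) \<bullet>c g i = g j \<bullet>c (\<phi> (mat_adjoint A) *\<^sub>v g i)"
      using cinner_adjoint[OF map_carrier[OF A] gc[OF ij(3)] gc[OF ir]] adjoint[OF A] by simp
    also have "\<dots> = cnj ((\<phi> (mat_adjoint A) *\<^sub>v g i) \<bullet>c g j)"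
      by (rule cinner_commute[OF mult_mat_vec_carrier[OF map_carrier[OF Ac] gc[OF ir]] gc[OF ij(3)]])
    also have "\<dots> = 0" using left[OF Ac ij(3,1)] ij(2) by simp
    finally show ?thesis .
  qed
  have "mat_adjoint ?U * \<phi> A * ?U = four_block_mat A (0\<^sub>m d (r - d)) (0\<^sub>m (r - d) d) (\<psi> A)"
    (is "?L = ?R") if A: "A \<in> carrier_mat d d" for A
  proof (rule eq_matI)
    fix i j assume "i < dim_row ?R" "j < dim_col ?R"
    then have ij: "i < r" "j < r" using A dr by (auto simp: \<psi>_def)
    have entry: "?L $$ (i, j) = (\<phi> A *\<^sub>v g j) \<bullet>c g i"
      using ij gc by (subst compression_index[OF cols_mat_carrier map_carrier[OF A]]) auto
    consider "j < d" | "d \<le> j" "i < d" | "d \<le> j" "d \<le> i" by linarith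
    then show "?L $$ (i, j) = ?R $$ (i, j)"
    proof cases
      case 1
      then show ?thesis using ij A dr unfolding entry left[OF A ij(1) 1] by (simp add: \<psi>_def)
    next
      case 2
      then show ?thesis using ij A dr unfolding entry right[OF A 2(2) 2(1) ij(2)] by (simp add: \<psi>_def)
    next
      case 3
      then show ?thesis using ij A dr by (simp add: \<psi>_def)
    qed
  qed (use A dr in \<open>auto simp: \<psi>_def\<close>)
  moreover have "\<psi> \<in> carrier_mat d d \<rightarrow> carrier_mat (r - d) (r - d)" by (auto simp: \<psi>_def)
  ultimately show ?thesis using unitary_cols_mat[OF g] by blast
qed

end

section \<open>Compressions and free spectrahedra\<close>

text \<open>
  The compression by the first \<open>d\<close> columns of \<open>U\<close> is the upper left block. It is applied with the
  identity and with transposition as \<open>\<theta>\<close>. The shape of the block matrix is what shows \<open>d \<le> r\<close>.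
\<close>

lemma block_diagonal_imp_compression:
  fixes U :: "complex mat" and \<phi> \<psi> \<theta> :: "complex mat \<Rightarrow> complex mat"
  assumes U: "U \<in> carrier_mat r r" and \<phi>: "\<phi> \<in> carrier_mat d d \<rightarrow> carrier_mat r r"
    and \<psi>: "\<psi> \<in> carrier_mat d d \<rightarrow> carrier_mat (r - d) (r - d)"
    and \<theta>: "\<And>A. A \<in> carrier_mat d d \<Longrightarrow> \<theta> A \<in> carrier_mat d d"
    and eq: "\<And>A. A \<in> carrier_mat d d \<Longrightarrow> mat_adjoint U * \<phi> A * U =
      four_block_mat (\<theta> A) (0\<^sub>m d (r - d)) (0\<^sub>m (r - d) d) (\<psi> A)"
  shows "\<exists>V\<in>carrier_mat r d. \<forall>A\<in>carrier_mat d d. mat_adjoint V * \<phi> A * V = \<theta> A"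
proof
  let ?V = "cols_mat r d (col U)"
  show "\<forall>A\<in>carrier_mat d d. mat_adjoint ?V * \<phi> A * ?V = \<theta> A"
  proof
    fix A :: "complex mat" assume A: "A \<in> carrier_mat d d"
    have \<phi>A: "\<phi> A \<in> carrier_mat r r" and \<psi>A: "\<psi> A \<in> carrier_mat (r - d) (r - d)"
      using A \<phi> \<psi> by auto
    have "dim_row (mat_adjoint U * \<phi> A * U) = d + (r - d)"
      using eq[OF A] \<theta>[OF A] \<psi>A by simp
    then have dr: "d \<le> r" using U by simp
    show "mat_adjoint ?V * \<phi> A * ?V = \<theta> A"
    proof (rule eq_matI)
      fix i j assume "i < dim_row (\<theta> A)" "j < dim_col (\<theta> A)"
      then have ij: "i < d" "j < d" using \<theta>[OF A] by auto
      have "(mat_adjoint ?V * \<phi> A * ?V) $$ (i, j) = (mat_adjoint U * \<phi> A * U) $$ (i, j)"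
      proof -
        have "col U k \<in> carrier_vec r" for k
          by (rule carrier_vecI) (simp only: dim_col carrier_matD(1)[OF U])
        then have col: "col ?V k = col U k" if "k < d" for k
          using that by (simp only: col_cols_mat)
        have "i < r" "j < r" using ij dr by simp_all
        then show ?thesis
          unfolding compression_index[OF cols_mat_carrier \<phi>A ij] col[OF ij(1)] col[OF ij(2)]
          by (rule compression_index[OF U \<phi>A, symmetric])
      qed
      then show "(mat_adjoint ?V * \<phi> A * ?V) $$ (i, j) = \<theta> A $$ (i, j)"
        using ij \<theta>[OF A] \<psi>A by (simp add: eq[OF A])
    qed (use \<theta>[OF A] in auto)
  qed
qed simp

text \<open>
  The compressed matrix \<open>(id \<otimes> \<theta>)(M)\<close> is \<open>(I \<otimes> V)* ((id \<otimes> \<phi>)(M)) (I \<otimes> V)\<close>, so its form at \<open>w\<close> is the form of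
  \<open>(id \<otimes> \<phi>)(M)\<close> at the vector with blocks \<open>V w\<^sub>k\<close>.
\<close>

lemma psd_id_tensor_compression:
  assumes V: "V \<in> carrier_mat r d"
    and \<phi>: "\<And>A. A \<in> carrier_mat d d \<Longrightarrow> \<phi> A \<in> carrier_mat r r"
    and \<theta>: "\<And>A. A \<in> carrier_mat d d \<Longrightarrow> \<theta> A \<in> carrier_mat d d"
    and adj: "\<And>A. A \<in> carrier_mat d d \<Longrightarrow> \<theta> (mat_adjoint A) = mat_adjoint (\<theta> A)"
    and eq: "\<And>A. A \<in> carrier_mat d d \<Longrightarrow> mat_adjoint V * \<phi> A * V = \<theta> A"
    and M: "M \<in> hermitian_mats (s * d)" and psd: "psd (id_tensor s d r \<phi> M)"
  shows "psd (id_tensor s d d \<theta> M)"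
  unfolding psd_iff_Re[OF id_tensor_carrier]
proof (intro conjI ballI)
  show "id_tensor s d d \<theta> M \<in> hermitian_mats (s * d)"
    using \<theta> adj M by (rule id_tensor_hermitian)
  fix w :: "complex vec" assume w: "w \<in> carrier_vec (s * d)"
  define w' where "w' = vec (s * r) (\<lambda>p. (V *\<^sub>v block_vec d w (p div r)) $ (p mod r))"
  have w': "w' \<in> carrier_vec (s * r)" by (simp add: w'_def)
  have blk: "block_vec r w' k = V *\<^sub>v block_vec d w k" if "k < s" for k
    using that V by (intro eq_vecI) (auto simp: block_vec_def w'_def block_index_less)
  have "(\<theta> B *\<^sub>v x) \<bullet>c y = (\<phi> B *\<^sub>v (V *\<^sub>v x)) \<bullet>c (V *\<^sub>v y)"
    if B: "B \<in> carrier_mat d d" and x: "x \<in> carrier_vec d" and y: "y \<in> carrier_vec d" for B x y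
  proof -
    note Vs = mat_adjoint_carrier[OF V]
    have Vx: "V *\<^sub>v x \<in> carrier_vec r" and Vy: "V *\<^sub>v y \<in> carrier_vec r"
      using V x y by (auto intro: mult_mat_vec_carrier)
    have \<phi>Vx: "\<phi> B *\<^sub>v (V *\<^sub>v x) \<in> carrier_vec r" by (rule mult_mat_vec_carrier[OF \<phi>[OF B] Vx])
    have "\<theta> B *\<^sub>v x = mat_adjoint V *\<^sub>v (\<phi> B *\<^sub>v (V *\<^sub>v x))"
      unfolding eq[OF B, symmetric]
      using assoc_mult_mat_vec[OF mult_carrier_mat[OF Vs \<phi>[OF B]] V x]
        assoc_mult_mat_vec[OF Vs \<phi>[OF B] Vx] by simp
    then have "(\<theta> B *\<^sub>v x) \<bullet>c y = cnj (y \<bullet>c (mat_adjoint V *\<^sub>v (\<phi> B *\<^sub>v (V *\<^sub>v x))))"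
      using cinner_commute[OF y mult_mat_vec_carrier[OF Vs \<phi>Vx]] by simp
    also have "\<dots> = cnj ((V *\<^sub>v y) \<bullet>c (\<phi> B *\<^sub>v (V *\<^sub>v x)))"
      by (simp only: cinner_adjoint[OF V y \<phi>Vx])
    also have "\<dots> = (\<phi> B *\<^sub>v (V *\<^sub>v x)) \<bullet>c (V *\<^sub>v y)"
      by (rule cinner_commute[OF Vy \<phi>Vx, symmetric])
    finally show ?thesis .
  qed
  then have "(id_tensor s d d \<theta> M *\<^sub>v w) \<bullet>c w = (id_tensor s d r \<phi> M *\<^sub>v w') \<bullet>c w'"
    by (simp add: id_tensor_form[OF \<theta> w] id_tensor_form[OF \<phi> w'] blk)
  then show "0 \<le> Re ((id_tensor s d d \<theta> M *\<^sub>v w) \<bullet>c w)"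
    using psd w' unfolding psd_iff_Re[OF id_tensor_carrier] by simp
qed

lemma block_id_tensor:
  assumes "\<phi> (block d M k l) \<in> carrier_mat r r" "k < s" "l < s"
  shows "block r (id_tensor s d r \<phi> M) k l = \<phi> (block d M k l)"
  using assms by (intro eq_matI) (auto simp: block_def[of r] id_tensor_def block_index_less)

text \<open>
  The partial transpose is an involution of \<open>her_tensor s d\<close> that exchanges \<open>Psd\<close> with \<open>Psd_Gamma\<close> and the
  spectrahedron of \<open>\<phi>\<close> with that of \<open>A \<mapsto> \<phi>(A\<^sup>T)\<close>.
\<close>

lemma spectrahedron_transpose_in_Psd:
  assumes "free_spectrahedron d r \<phi> s \<subseteq> Psd_Gamma d s"
  shows "free_spectrahedron d r (\<lambda>A. \<phi> (transpose_mat A)) s \<subseteq> Psd d s"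
proof
  fix A assume A: "A \<in> free_spectrahedron d r (\<lambda>A. \<phi> (transpose_mat A)) s"
  let ?G = "id_tensor s d d transpose_mat A"
  have her: "A \<in> her_tensor s d" and psd: "psd (id_tensor s d r (\<lambda>A. \<phi> (transpose_mat A)) A)"
    using A by (auto simp: free_spectrahedron_def)
  have Ac: "A \<in> carrier_mat (s * d) (s * d)"
    using her_tensor_hermitian[OF her] by (simp add: hermitian_mats_iff)
  have blk: "block d ?G k l = transpose_mat (block d A k l)" if "k < s" "l < s" for k l
    using that by (intro block_id_tensor) simp_all
  obtain N X Y where XY: "A = tensor_sum s d N X Y"
      "\<forall>k<N. X k \<in> hermitian_mats s \<and> Y k \<in> hermitian_mats d"
    using her by (auto simp: her_tensor_def)
  have "?G = tensor_sum s d N X (\<lambda>k. transpose_mat (Y k))"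
    unfolding XY(1) using XY(2)
    by (intro id_tensor_tensor_sum) (auto simp: hermitian_mats_def transpose_add)
  moreover have "\<forall>k<N. X k \<in> hermitian_mats s \<and> transpose_mat (Y k) \<in> hermitian_mats d"
    using XY(2) by (auto simp: hermitian_mats_iff)
  ultimately have "?G \<in> her_tensor s d" unfolding her_tensor_def by blast
  moreover have "id_tensor s d r \<phi> ?G = id_tensor s d r (\<lambda>A. \<phi> (transpose_mat A)) A"
    unfolding id_tensor_def[of s d r] by (intro eq_matI) (auto simp: blk div_less_mult)
  ultimately have "?G \<in> Psd_Gamma d s" using assms psd by (auto simp: free_spectrahedron_def)
  then have "psd (id_tensor s d d transpose_mat ?G)" by (simp add: Psd_Gamma_partial_transpose)
  moreover have "id_tensor s d d transpose_mat ?G = A"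
  proof -
    have "id_tensor s d d transpose_mat ?G = id_tensor s d d (\<lambda>A. A) A"
      unfolding id_tensor_def[of s d d transpose_mat ?G] id_tensor_def[of s d d "\<lambda>A. A"]
      by (intro eq_matI) (auto simp: blk div_less_mult)
    then show ?thesis using id_tensor_id[OF Ac] by simp
  qed
  ultimately show "A \<in> Psd d s" using her by (simp add: Psd_def)
qed

section \<open>The equivalence\<close>

lemma matrix_unit_transpose: "transpose_mat (matrix_unit d i j) = matrix_unit d j i"
  by (intro eq_matI) (auto simp: matrix_unit_def)

lemma all_equivalent_cycle:
  "(P \<Longrightarrow> S) \<Longrightarrow> (S \<Longrightarrow> R) \<Longrightarrow> (R \<Longrightarrow> Q) \<Longrightarrow> (Q \<Longrightarrow> P) \<Longrightarrow> all_equivalent [P, Q, R, S]"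
  by (auto simp: all_equivalent_def)

theorem theorem3p11:
  fixes d r :: nat and \<phi> :: "complex mat \<Rightarrow> complex mat"
  assumes "unital_star_isometry d r \<phi>"
  shows "all_equivalent
   [\<comment> \<open>(i)\<close>
    (\<forall>s\<ge>1. free_spectrahedron d r \<phi> s \<subseteq> Psd d s) \<or>
    (\<forall>s\<ge>1. free_spectrahedron d r \<phi> s \<subseteq> Psd_Gamma d s),
    \<comment> \<open>(ii)\<close>
    \<exists>V\<in>carrier_mat r d.
      (\<forall>A\<in>carrier_mat d d. mat_adjoint V * \<phi> A * V = A) \<or>
      (\<forall>A\<in>carrier_mat d d. mat_adjoint V * \<phi> A * V = transpose_mat A),
    \<comment> \<open>(iii)\<close>
    \<exists>U \<psi>. unitary_mat r U \<and> \<psi> \<in> carrier_mat d d \<rightarrow> carrier_mat (r - d) (r - d) \<and>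
      ((\<forall>A\<in>carrier_mat d d. mat_adjoint U * \<phi> A * U =
          four_block_mat A (0\<^sub>m d (r - d)) (0\<^sub>m (r - d) d) (\<psi> A)) \<or>
       (\<forall>A\<in>carrier_mat d d. mat_adjoint U * \<phi> A * U =
          four_block_mat (transpose_mat A) (0\<^sub>m d (r - d)) (0\<^sub>m (r - d) d) (\<psi> A))),
    \<comment> \<open>(iv)\<close>
    \<exists>h :: nat \<Rightarrow> complex vec.
      (\<forall>i<d. h i \<in> carrier_vec r \<and> euclid_norm (h i) = 1) \<and>
      ((\<forall>i<d. \<forall>j<d. \<forall>s<d. \<phi> (matrix_unit d i j) *\<^sub>v h s = (if j = s then 1 else 0) \<cdot>\<^sub>v h i) \<or>
       (\<forall>i<d. \<forall>j<d. \<forall>s<d. \<phi> (matrix_unit d i j) *\<^sub>v h s = (if i = s then 1 else 0) \<cdot>\<^sub>v h j))]"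
  (is "all_equivalent [?i, ?ii, ?iii, ?iv]")
proof -
  interpret unital_positive_map d r \<phi> by (rule unital_star_isometry_imp_positive[OF assms])
  let ?\<phi>T = "\<lambda>A. \<phi> (transpose_mat A)"
  interpret T: unital_positive_map d r ?\<phi>T
    by (rule unital_positive_map_transpose) unfold_locales
  have "?i \<Longrightarrow> ?iv"
  proof (elim disjE)
    assume "\<forall>s\<ge>1. free_spectrahedron d r \<phi> s \<subseteq> Psd d s"
    then show ?iv using spectrahedron_in_Psd_imp_unit_vectors by blast
  next
    assume "\<forall>s\<ge>1. free_spectrahedron d r \<phi> s \<subseteq> Psd_Gamma d s"
    then have "\<And>s. 1 \<le> s \<Longrightarrow> free_spectrahedron d r ?\<phi>T s \<subseteq> Psd d s"
      using spectrahedron_transpose_in_Psd by blast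
    then obtain h where "\<forall>i<d. h i \<in> carrier_vec r \<and> euclid_norm (h i) = 1"
      "\<forall>i<d. \<forall>j<d. \<forall>s<d. ?\<phi>T (matrix_unit d i j) *\<^sub>v h s = (if j = s then 1 else 0) \<cdot>\<^sub>v h i"
      using T.spectrahedron_in_Psd_imp_unit_vectors by blast
    then show ?iv unfolding matrix_unit_transpose by blast
  qed
  moreover have "?iv \<Longrightarrow> ?iii"
  proof (elim exE conjE disjE)
    fix h assume "\<forall>i<d. h i \<in> carrier_vec r \<and> euclid_norm (h i) = 1"
      "\<forall>i<d. \<forall>j<d. \<forall>s<d. \<phi> (matrix_unit d i j) *\<^sub>v h s = (if j = s then 1 else 0) \<cdot>\<^sub>v h i"
    then show ?iii using unit_vectors_imp_block_diagonal[of h] by blast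
  next
    fix h assume h: "\<forall>i<d. h i \<in> carrier_vec r \<and> euclid_norm (h i) = 1"
      "\<forall>i<d. \<forall>j<d. \<forall>s<d. \<phi> (matrix_unit d i j) *\<^sub>v h s = (if i = s then 1 else 0) \<cdot>\<^sub>v h j"
    then have "\<exists>U \<psi>. unitary_mat r U \<and> \<psi> \<in> carrier_mat d d \<rightarrow> carrier_mat (r - d) (r - d) \<and>
        (\<forall>A\<in>carrier_mat d d. mat_adjoint U * ?\<phi>T A * U =
          four_block_mat A (0\<^sub>m d (r - d)) (0\<^sub>m (r - d) d) (\<psi> A))"
      by (intro T.unit_vectors_imp_block_diagonal[of h]) (auto simp: matrix_unit_transpose)
    then obtain U \<psi> where U: "unitary_mat r U"
      and \<psi>: "\<psi> \<in> carrier_mat d d \<rightarrow> carrier_mat (r - d) (r - d)"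
      and eq: "\<forall>A\<in>carrier_mat d d. mat_adjoint U * ?\<phi>T A * U =
          four_block_mat A (0\<^sub>m d (r - d)) (0\<^sub>m (r - d) d) (\<psi> A)" by blast
    have "mat_adjoint U * \<phi> A * U =
        four_block_mat (transpose_mat A) (0\<^sub>m d (r - d)) (0\<^sub>m (r - d) d) (\<psi> (transpose_mat A))"
      if "A \<in> carrier_mat d d" for A
      using bspec[OF eq, of "transpose_mat A"] that by simp
    then show ?iii using U \<psi> by (intro exI[of _ U] exI[of _ "\<lambda>A. \<psi> (transpose_mat A)"]) auto
  qed
  moreover have "?iii \<Longrightarrow> ?ii"
  proof (elim exE conjE disjE)
    fix U \<psi> assume U: "unitary_mat r U"
      and \<psi>: "\<psi> \<in> carrier_mat d d \<rightarrow> carrier_mat (r - d) (r - d)"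
      and eq: "\<forall>A\<in>carrier_mat d d. mat_adjoint U * \<phi> A * U =
          four_block_mat A (0\<^sub>m d (r - d)) (0\<^sub>m (r - d) d) (\<psi> A)"
    show ?ii
      using block_diagonal_imp_compression[OF _ maps \<psi>, of U "\<lambda>A. A"] U eq
      by (auto simp: unitary_mat_def)
  next
    fix U \<psi> assume U: "unitary_mat r U"
      and \<psi>: "\<psi> \<in> carrier_mat d d \<rightarrow> carrier_mat (r - d) (r - d)"
      and eq: "\<forall>A\<in>carrier_mat d d. mat_adjoint U * \<phi> A * U =
          four_block_mat (transpose_mat A) (0\<^sub>m d (r - d)) (0\<^sub>m (r - d) d) (\<psi> A)"
    show ?ii
      using block_diagonal_imp_compression[OF _ maps \<psi>, of U transpose_mat] U eq
      by (auto simp: unitary_mat_def)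
  qed
  moreover have "?ii \<Longrightarrow> ?i"
  proof (elim bexE disjE)
    fix V assume V: "V \<in> carrier_mat r d"
      and eq: "\<forall>A\<in>carrier_mat d d. mat_adjoint V * \<phi> A * V = A"
    have "psd A" if "A \<in> her_tensor s d" "psd (id_tensor s d r \<phi> A)" for s A
    proof -
      have her: "A \<in> hermitian_mats (s * d)" by (rule her_tensor_hermitian[OF that(1)])
      then have "psd (id_tensor s d d (\<lambda>A. A) A)"
        using eq that(2) by (intro psd_id_tensor_compression[OF V map_carrier]) auto
      then show ?thesis using her id_tensor_id by (simp add: hermitian_mats_iff)
    qed
    then show ?i by (auto simp: free_spectrahedron_def Psd_def)
  next
    fix V assume V: "V \<in> carrier_mat r d"
      and eq: "\<forall>A\<in>carrier_mat d d. mat_adjoint V * \<phi> A * V = transpose_mat A"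
    have "psd (id_tensor s d d transpose_mat A)"
      if "A \<in> her_tensor s d" "psd (id_tensor s d r \<phi> A)" for s A
      using eq that her_tensor_hermitian
      by (intro psd_id_tensor_compression[OF V map_carrier]) (auto simp: mat_adjoint_transpose)
    then show ?i by (auto simp: free_spectrahedron_def Psd_Gamma_partial_transpose)
  qed
  ultimately show ?thesis by (rule all_equivalent_cycle)
qed

end
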